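(* Let $A\subset C$ and $B\subset D$ be unital inclusions of unital $C^*$-algebras which are strongly Morita equivalent with respect to a $C-D$-equivalence bimodule $Y$ and its closed subspace $X$. Let $E^A:C\to A$ and $E^B:D\to B$ be conditional expectations of Watatani index-finite type and let $E^X$ be a conditional expectation from $Y$ onto $X$ with respect to $E^A$ and $E^B$. Suppose $\mathrm{Ind}_W(E^A)\in A$ (so that also $\mathrm{Ind}_W(E^B)\in B$), and suppose that there are full projections $p\in C$ and $q\in D$ with $E^A(p)=\mathrm{Ind}_W(E^A)^{-1}$ and $E^B(q)=\mathrm{Ind}_W(E^B)^{-1}$. Let $P=\{p\}'\cap A$, $Q=\{q\}'\cap B$, let $E^P:A\to P$, $E^Q:B\to Q$ be the conditional expectations $$E^P(a)=\mathrm{Ind}_W(E^A)E^A(pap),\qquad E^Q(b)=\mathrm{Ind}_W(E^B)E^B(qbq),$$ and let $Z=\{x\in X\mid p\cdot x=x\cdot q\}$. Then the unital inclusions $P\subset A$ and $Q\subset B$ are strongly Morita equivalent with respect to the $A-B$-equivalence bimodule $X$ and its closed subspace $Z$, and there is a conditional expectation from $X$ onto $Z$ with respect to $E^P$ and $E^Q$.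
   Context: Equivalence bimodules are imprimitivity bimodules; actions are written $c\cdot y$, $y\cdot d$; ${}_C\langle\ ,\ \rangle$ (linear in the first variable) and $\langle\ ,\ \rangle_D$ (linear in the second variable) are the inner products. For sets, $\langle U,V\rangle$ means the linear span of the inner products. A projection $p\in C$ is full if $CpC=C$ (linear span). Strong Morita equivalence of inclusions: unital inclusions $A\subset C$, $B\subset D$ are strongly Morita equivalent with respect to a $C-D$-equivalence bimodule $Y$ and its closed subspace $X$ if (1) $a\cdot x\in X$ and ${}_C\langle x,y\rangle\in A$ for $a\in A$, $x,y\in X$, and $\overline{{}_C\langle X,X\rangle}=A$, $\overline{{}_C\langle Y,X\rangle}=C$; (2) $x\cdot b\in X$ and $\langle x,y\rangle_D\in B$ for $b\in B$, $x,y\in X$, and $\overline{\langle X,X\rangle_D}=B$, $\overline{\langle Y,X\rangle_D}=D$. Then $X$ is an $A-B$-equivalence bimodule. In that situation a linear map $E^X$ from $Y$ onto $X$ is a conditional expectation with respect to conditional expectations $E^A:C\to A$ and $E^B:D\to B$ if, for all $a\in A,b\in B,c\in C,d\in D,x\in X,y\in Y$: $E^X(c\cdot x)=E^A(c)\cdot x$; $E^X(a\cdot y)=a\cdot E^X(y)$; $E^A({}_C\langle y,x\rangle)={}_C\langle E^X(y),x\rangle$; $E^X(x\cdot d)=x\cdot E^B(d)$; $E^X(y\cdot b)=E^X(y)\cdot b$; $E^B(\langle y,x\rangle_D)=\langle E^X(y),x\rangle_D$. $E^A$ is of Watatani index-finite type if it has a quasi-basis: a finite family $\{(u_i,u_i^*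 )\}$ with $u_i\in C$ and $\sum_i u_iE^A(u_i^*c)=c=\sum_i E^A(cu_i)u_i^*$ for all $c\in C$; then $\mathrm{Ind}_W(E^A)=\sum_i u_iu_i^*\in C\cap C'$, which is positive and invertible. Under these hypotheses the following is known (Osaka–Kodaka–Teruya): $E^P$, $E^Q$ are conditional expectations with $\mathrm{Ind}_W(E^P)=\mathrm{Ind}_W(E^A)\in P\cap C'$, $\mathrm{Ind}_W(E^Q)=\mathrm{Ind}_W(E^B)\in Q\cap D'$; $ApA=C$, $BqB=D$; $pap=E^P(a)p$, $qbq=E^Q(b)q$ for $a\in A$, $b\in B$; and $A\subset C$, $B\subset D$ can be regarded as the $C^*$-basic constructions of $P\subset A$, $Q\subset B$. *)

theory Defs
  imports "HOL-Analysis.Analysis"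
begin

section \<open>Complex normed spaces and unital C*-algebras\<close>

class scaleC =
  fixes scaleC :: "complex \<Rightarrow> 'a \<Rightarrow> 'a" (infixr "*\<^sub>C" 75)

class complex_vector = scaleC + real_vector +
  assumes scaleC_add_right: "z *\<^sub>C (x + y) = z *\<^sub>C x + z *\<^sub>C y"
    and scaleC_add_left: "(z + w) *\<^sub>C x = z *\<^sub>C x + w *\<^sub>C x"
    and scaleC_scaleC: "z *\<^sub>C w *\<^sub>C x = (z * w) *\<^sub>C x"
    and scaleR_scaleC: "r *\<^sub>R x = complex_of_real r *\<^sub>C x"

global_interpretation complex_vector: vector_space "scaleC :: complex \<Rightarrow> 'a \<Rightarrow> 'a::complex_vector"
  defines csubspace = complex_vector.subspace
    and cspan = complex_vector.span
proof
  show "1 *\<^sub>C x = x" for x :: 'a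
    using scaleR_scaleC[of 1 x] by simp
qed (simp_all add: scaleC_add_right scaleC_add_left scaleC_scaleC)

class complex_normed_vector = complex_vector + real_normed_vector +
  assumes norm_scaleC: "norm (z *\<^sub>C x) = cmod z * norm x"

class star =
  fixes star :: "'a \<Rightarrow> 'a"

class unital_cstar_algebra = complex_normed_vector + real_normed_algebra_1 + banach + star +
  assumes mult_scaleC_left: "(z *\<^sub>C x) * y = z *\<^sub>C (x * y)"
    and mult_scaleC_right: "x * (z *\<^sub>C y) = z *\<^sub>C (x * y)"
    and star_star: "star (star x) = x"
    and star_add: "star (x + y) = star x + star y"
    and star_scaleC: "star (z *\<^sub>C x) = cnj z *\<^sub>C star x"
    and star_mult: "star (x * y) = star y * star x"
    and norm_star_mult_self: "norm (star x * x) = (norm x)\<^sup>2"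

text \<open>
  The algebras of the theory are closed unital *-subalgebras of a type of class
  \<^class>\<open>unital_cstar_algebra\<close> (possibly all of it).  Positivity is taken in the whole type; by
  spectral permanence an element of a unital C*-subalgebra is positive there iff it is positive here.
\<close>

definition cstar_positive :: "'c::unital_cstar_algebra \<Rightarrow> bool"
  where "cstar_positive a \<longleftrightarrow> (\<exists>b. a = star b * b)"

definition unital_cstar_subalgebra :: "'c::unital_cstar_algebra set \<Rightarrow> bool"
  where "unital_cstar_subalgebra A \<longleftrightarrow>
    csubspace A \<and> closed A \<and> 1 \<in> A \<and> (\<forall>a\<in>A. star a \<in> A) \<and> (\<forall>a\<in>A. \<forall>b\<in>A. a * b \<in> A)"

definition unital_inclusion :: "'c::unital_cstar_algebra set \<Rightarrow> 'c set \<Rightarrow> bool"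
  where "unital_inclusion A C \<longleftrightarrow>
    unital_cstar_subalgebra A \<and> unital_cstar_subalgebra C \<and> A \<subseteq> C"

definition full_projection :: "'c::unital_cstar_algebra set \<Rightarrow> 'c \<Rightarrow> bool"
  where "full_projection C p \<longleftrightarrow>
    p \<in> C \<and> star p = p \<and> p * p = p \<and> cspan {a * p * b |a b. a \<in> C \<and> b \<in> C} = C"

definition clinear_on :: "'v::complex_vector set \<Rightarrow> ('v \<Rightarrow> 'w::complex_vector) \<Rightarrow> bool"
  where "clinear_on V f \<longleftrightarrow>
    (\<forall>x\<in>V. \<forall>y\<in>V. f (x + y) = f x + f y) \<and> (\<forall>z. \<forall>x\<in>V. f (z *\<^sub>C x) = z *\<^sub>C f x)"


section \<open>Equivalence bimodules\<close>

definition ip_span :: "('y \<Rightarrow> 'y \<Rightarrow> 'c::complex_vector) \<Rightarrow> 'y set \<Rightarrow> 'y set \<Rightarrow> 'c set"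
  where "ip_span ip U V = cspan {ip x y |x y. x \<in> U \<and> y \<in> V}"

text \<open>
  The norm of the type of the module is required to be the one given by the inner product, so that
  \<^const>\<open>complete\<close> and \<^const>\<open>closed\<close> have their usual Hilbert module meaning.  Since the two inner
  products of an equivalence bimodule always induce the same norm, this can be asked of both sides.
\<close>

locale full_left_hilbert_module =
  fixes C :: "'c::unital_cstar_algebra set"
    and Y :: "'y::complex_normed_vector set"
    and lact :: "'c \<Rightarrow> 'y \<Rightarrow> 'y"
    and lip :: "'y \<Rightarrow> 'y \<Rightarrow> 'c"
  assumes left_algebra: "unital_cstar_subalgebra C"
    and left_subspace: "csubspace Y"
    and lact_closed: "\<lbrakk>c \<in> C; y \<in> Y\<rbrakk> \<Longrightarrow> lact c y \<in> Y"
    and lact_one: "y \<in> Y \<Longrightarrow> lact 1 y = y"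
    and lact_mult: "\<lbrakk>c \<in> C; c' \<in> C; y \<in> Y\<rbrakk> \<Longrightarrow> lact (c * c') y = lact c (lact c' y)"
    and lact_linear_left: "y \<in> Y \<Longrightarrow> clinear_on C (\<lambda>c. lact c y)"
    and lact_linear_right: "c \<in> C \<Longrightarrow> clinear_on Y (lact c)"
    and lip_closed: "\<lbrakk>x \<in> Y; y \<in> Y\<rbrakk> \<Longrightarrow> lip x y \<in> C"
    and lip_linear: "y \<in> Y \<Longrightarrow> clinear_on Y (\<lambda>x. lip x y)"
    and lip_lact: "\<lbrakk>c \<in> C; x \<in> Y; y \<in> Y\<rbrakk> \<Longrightarrow> lip (lact c x) y = c * lip x y"
    and star_lip: "\<lbrakk>x \<in> Y; y \<in> Y\<rbrakk> \<Longrightarrow> star (lip x y) = lip y x"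
    and lip_positive: "x \<in> Y \<Longrightarrow> cstar_positive (lip x x)"
    and lip_norm: "x \<in> Y \<Longrightarrow> norm x = sqrt (norm (lip x x))"
    and left_complete: "complete Y"
    and left_full: "closure (ip_span lip Y Y) = C"

locale full_right_hilbert_module =
  fixes D :: "'d::unital_cstar_algebra set"
    and Y :: "'y::complex_normed_vector set"
    and ract :: "'y \<Rightarrow> 'd \<Rightarrow> 'y"
    and rip :: "'y \<Rightarrow> 'y \<Rightarrow> 'd"
  assumes right_algebra: "unital_cstar_subalgebra D"
    and right_subspace: "csubspace Y"
    and ract_closed: "\<lbrakk>y \<in> Y; d \<in> D\<rbrakk> \<Longrightarrow> ract y d \<in> Y"
    and ract_one: "y \<in> Y \<Longrightarrow> ract y 1 = y"
    and ract_mult: "\<lbrakk>y \<in> Y; d \<in> D; d' \<in> D\<rbrakk> \<Longrightarrow> ract y (d * d') = ract (ract y d) d'"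
    and ract_linear_left: "d \<in> D \<Longrightarrow> clinear_on Y (\<lambda>y. ract y d)"
    and ract_linear_right: "y \<in> Y \<Longrightarrow> clinear_on D (ract y)"
    and rip_closed: "\<lbrakk>x \<in> Y; y \<in> Y\<rbrakk> \<Longrightarrow> rip x y \<in> D"
    and rip_linear: "x \<in> Y \<Longrightarrow> clinear_on Y (rip x)"
    and rip_ract: "\<lbrakk>x \<in> Y; y \<in> Y; d \<in> D\<rbrakk> \<Longrightarrow> rip x (ract y d) = rip x y * d"
    and star_rip: "\<lbrakk>x \<in> Y; y \<in> Y\<rbrakk> \<Longrightarrow> star (rip x y) = rip y x"
    and rip_positive: "x \<in> Y \<Longrightarrow> cstar_positive (rip x x)"
    and rip_norm: "x \<in> Y \<Longrightarrow> norm x = sqrt (norm (rip x x))"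
    and right_complete: "complete Y"
    and right_full: "closure (ip_span rip Y Y) = D"

locale equivalence_bimodule =
  full_left_hilbert_module C Y lact lip + full_right_hilbert_module D Y ract rip
  for C :: "'c::unital_cstar_algebra set"
    and D :: "'d::unital_cstar_algebra set"
    and Y :: "'y::complex_normed_vector set"
    and lact :: "'c \<Rightarrow> 'y \<Rightarrow> 'y"
    and ract :: "'y \<Rightarrow> 'd \<Rightarrow> 'y"
    and lip :: "'y \<Rightarrow> 'y \<Rightarrow> 'c"
    and rip :: "'y \<Rightarrow> 'y \<Rightarrow> 'd" +
  assumes lact_ract: "\<lbrakk>c \<in> C; y \<in> Y; d \<in> D\<rbrakk> \<Longrightarrow> ract (lact c y) d = lact c (ract y d)"
    and rip_lact: "\<lbrakk>c \<in> C; x \<in> Y; y \<in> Y\<rbrakk> \<Longrightarrow> rip (lact c x) y = rip x (lact (star c) y)"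
    and lip_ract: "\<lbrakk>x \<in> Y; y \<in> Y; d \<in> D\<rbrakk> \<Longrightarrow> lip (ract x d) y = lip x (ract y (star d))"
    and lip_rip: "\<lbrakk>x \<in> Y; y \<in> Y; z \<in> Y\<rbrakk> \<Longrightarrow> lact (lip x y) z = ract x (rip y z)"


section \<open>Strong Morita equivalence of unital inclusions\<close>

text \<open>
  The inclusions \<open>A \<subseteq> C\<close> and \<open>B \<subseteq> D\<close> are strongly Morita equivalent with respect to the
  \<open>C\<close>-\<open>D\<close>-equivalence bimodule \<open>Y\<close> and its closed subspace \<open>X\<close>.
\<close>

locale strongly_Morita_equivalent_inclusions =
  equivalence_bimodule C D Y lact ract lip rip
  for A C :: "'c::unital_cstar_algebra set"
    and B D :: "'d::unital_cstar_algebra set"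
    and Y X :: "'y::complex_normed_vector set"
    and lact :: "'c \<Rightarrow> 'y \<Rightarrow> 'y"
    and ract :: "'y \<Rightarrow> 'd \<Rightarrow> 'y"
    and lip :: "'y \<Rightarrow> 'y \<Rightarrow> 'c"
    and rip :: "'y \<Rightarrow> 'y \<Rightarrow> 'd" +
  assumes left_inclusion: "unital_inclusion A C"
    and right_inclusion: "unital_inclusion B D"
    and X_subset: "X \<subseteq> Y"
    and X_subspace: "csubspace X"
    and X_closed: "closed X"
    and X_lact: "\<lbrakk>a \<in> A; x \<in> X\<rbrakk> \<Longrightarrow> lact a x \<in> X"
    and X_lip: "\<lbrakk>x \<in> X; y \<in> X\<rbrakk> \<Longrightarrow> lip x y \<in> A"
    and XX_left_full: "closure (ip_span lip X X) = A"
    and YX_left_full: "closure (ip_span lip Y X) = C"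
    and X_ract: "\<lbrakk>x \<in> X; b \<in> B\<rbrakk> \<Longrightarrow> ract x b \<in> X"
    and X_rip: "\<lbrakk>x \<in> X; y \<in> X\<rbrakk> \<Longrightarrow> rip x y \<in> B"
    and XX_right_full: "closure (ip_span rip X X) = B"
    and YX_right_full: "closure (ip_span rip Y X) = D"


section \<open>Conditional expectations and the Watatani index\<close>

text \<open>
  Contractivity need not be required: a positive unital linear map has norm at most one.
\<close>

definition conditional_expectation ::
    "'c::unital_cstar_algebra set \<Rightarrow> 'c set \<Rightarrow> ('c \<Rightarrow> 'c) \<Rightarrow> bool"
  where "conditional_expectation A C E \<longleftrightarrow>
    unital_inclusion A C \<and> clinear_on C E \<and>
    (\<forall>c\<in>C. E c \<in> A) \<and> (\<forall>a\<in>A. E a = a) \<and>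
    (\<forall>a\<in>A. \<forall>c\<in>C. E (a * c) = a * E c \<and> E (c * a) = E c * a) \<and>
    (\<forall>c\<in>C. cstar_positive c \<longrightarrow> cstar_positive (E c))"

definition quasi_basis ::
    "'c::unital_cstar_algebra set \<Rightarrow> ('c \<Rightarrow> 'c) \<Rightarrow> nat \<Rightarrow> (nat \<Rightarrow> 'c) \<Rightarrow> bool"
  where "quasi_basis C E n u \<longleftrightarrow>
    (\<forall>i<n. u i \<in> C) \<and>
    (\<forall>c\<in>C. (\<Sum>i<n. u i * E (star (u i) * c)) = c \<and> (\<Sum>i<n. E (c * u i) * star (u i)) = c)"

definition index_finite_type :: "'c::unital_cstar_algebra set \<Rightarrow> ('c \<Rightarrow> 'c) \<Rightarrow> bool"
  where "index_finite_type C E \<longleftrightarrow> (\<exists>n u. quasi_basis C E n u)"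

text \<open>
  The description is proper whenever a quasi-basis exists: the sum does not depend on the
  quasi-basis.
\<close>

definition Ind_W :: "'c::unital_cstar_algebra set \<Rightarrow> ('c \<Rightarrow> 'c) \<Rightarrow> 'c"
  where "Ind_W C E = (THE k. \<exists>n u. quasi_basis C E n u \<and> k = (\<Sum>i<n. u i * star (u i)))"

text \<open>
  \<open>E\<^sub>X\<close> is a conditional expectation from \<open>Y\<close> onto \<open>X\<close> with respect to the conditional
  expectations \<open>E\<^sub>A\<close> from \<open>C\<close> onto \<open>A\<close> and \<open>E\<^sub>B\<close> from \<open>D\<close> onto \<open>B\<close>.
\<close>

locale bimodule_conditional_expectation =
  strongly_Morita_equivalent_inclusions A C B D Y X lact ract lip rip
  for A C :: "'c::unital_cstar_algebra set"
    and B D :: "'d::unital_cstar_algebra set"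
    and Y X :: "'y::complex_normed_vector set"
    and lact :: "'c \<Rightarrow> 'y \<Rightarrow> 'y"
    and ract :: "'y \<Rightarrow> 'd \<Rightarrow> 'y"
    and lip :: "'y \<Rightarrow> 'y \<Rightarrow> 'c"
    and rip :: "'y \<Rightarrow> 'y \<Rightarrow> 'd" +
  fixes E\<^sub>A :: "'c \<Rightarrow> 'c"
    and E\<^sub>B :: "'d \<Rightarrow> 'd"
    and E\<^sub>X :: "'y \<Rightarrow> 'y"
  assumes EA_conditional_expectation: "conditional_expectation A C E\<^sub>A"
    and EB_conditional_expectation: "conditional_expectation B D E\<^sub>B"
    and EX_linear: "clinear_on Y E\<^sub>X"
    and EX_onto: "E\<^sub>X ` Y = X"
    and EX_lact_X: "\<lbrakk>c \<in> C; x \<in> X\<rbrakk> \<Longrightarrow> E\<^sub>X (lact c x) = lact (E\<^sub>A c) x"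
    and EX_lact_A: "\<lbrakk>a \<in> A; y \<in> Y\<rbrakk> \<Longrightarrow> E\<^sub>X (lact a y) = lact a (E\<^sub>X y)"
    and EA_lip: "\<lbrakk>y \<in> Y; x \<in> X\<rbrakk> \<Longrightarrow> E\<^sub>A (lip y x) = lip (E\<^sub>X y) x"
    and EX_ract_X: "\<lbrakk>x \<in> X; d \<in> D\<rbrakk> \<Longrightarrow> E\<^sub>X (ract x d) = ract x (E\<^sub>B d)"
    and EX_ract_B: "\<lbrakk>y \<in> Y; b \<in> B\<rbrakk> \<Longrightarrow> E\<^sub>X (ract y b) = ract (E\<^sub>X y) b"
    and EB_rip: "\<lbrakk>y \<in> Y; x \<in> X\<rbrakk> \<Longrightarrow> E\<^sub>B (rip y x) = rip (E\<^sub>X y) x"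

end

theory Submission
  imports Defs
begin

text \<open>
  Write \<open>k\<close> for the index of \<open>E\<^sub>A\<close> and \<open>l\<close> for the index of \<open>E\<^sub>B\<close>.  Both are central, and they
  act on the bimodule in the same way: \<open>k \<cdot> y = y \<cdot> l\<close>, because a quasi-basis of \<open>E\<^sub>A\<close> reproduces
  \<open>y\<close> through \<open>E\<^sub>X\<close> from the left and one of \<open>E\<^sub>B\<close> does so from the right, and the two expansions
  can be interchanged (\<open>index_action\<close>).  This gives \<open>l \<in> B\<close> and makes all later formulas
  symmetric in left and right.

  The projections enter through the single identity \<open>p c = k p E\<^sub>A(p c)\<close> for all \<open>c\<close>
  (\<open>p_mult_eq\<close>).  In the basic construction of \<open>A \<subseteq> C\<close> with Jones projection \<open>e\<close>, the element
  \<open>k p e p\<close> is a projection below \<open>p\<close>, and the dual conditional expectation sends both to the same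
  element, so that they are equal by faithfulness.  The proof here carries out this argument
  with a quasi-basis inside \<open>C\<close>; faithfulness becomes the fact that a finite sum
  \<open>\<Sum> a\<^sub>i a\<^sub>i\<^sup>*\<close> vanishes only if every \<open>a\<^sub>i\<close> does.  That fact rests on the positivity of
  \<open>b\<^sup>* b\<close>, which is derived from a power series for the square root.

  The identity has three consequences: \<open>p a p = E\<^sub>P(a) p\<close>; the fullness of \<open>p\<close> in \<open>C\<close> is already
  witnessed by elements of \<open>A\<close>, i.e. 1 lies in the span of \<open>A p A\<close>; and its bimodule version
  \<open>p \<cdot> y = k p \<cdot> E\<^sub>X(p \<cdot> y)\<close>, together with its mirror image, shows that
  \<open>E\<^sub>Z(x) = k \<cdot> E\<^sub>X(p \<cdot> x \<cdot> q)\<close> takes its values in \<open>Z\<close>.  The identities required of a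
  conditional expectation onto \<open>Z\<close> are then direct computations.

  For the density conditions it suffices to have 1 in the spans, and a dense left ideal of a unital
  Banach algebra contains 1, so no limits occur.  Writing 1 as a sum of elements \<open>b q b'\<close> with
  \<open>b, b' \<in> B\<close> gives \<open>x = \<Sum> E\<^sub>Z(x \<cdot> b) \<cdot> b'\<close>, hence \<open>X\<close> is the span of \<open>Z \<cdot> B\<close>.
  Therefore 1 lies in the span of \<open>\<langle>X, X\<rangle> = \<langle>X, Z \<cdot> B\<rangle> = \<langle>X \<cdot> B, Z\<rangle> = \<langle>X, Z\<rangle>\<close>, and applying
  \<open>E\<^sub>P\<close> moves it into the span of \<open>\<langle>E\<^sub>Z(X), Z\<rangle> = \<langle>Z, Z\<rangle>\<close>.
\<close>


section \<open>Positive elements of a unital C*-algebra\<close>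

lemma star_zero [simp]: "star (0::'a::unital_cstar_algebra) = 0"
  using star_add[of "0::'a" 0] by simp

lemma star_minus [simp]: "star (- x) = - star (x::'a::unital_cstar_algebra)"
  using star_add[of x "-x"] by (simp add: eq_neg_iff_add_eq_0 add.commute)

lemma star_diff: "star (x - y) = star x - star (y::'a::unital_cstar_algebra)"
  using star_add[of x "-y"] by simp

lemma star_one [simp]: "star (1::'a::unital_cstar_algebra) = 1"
  by (metis mult.right_neutral star_mult star_star)

lemma star_scaleR: "star (r *\<^sub>R x) = r *\<^sub>R star (x::'a::unital_cstar_algebra)"
  by (simp add: scaleR_scaleC star_scaleC)

lemma star_sum: "star (sum f I) = (\<Sum>i\<in>I. star (f i :: 'a::unital_cstar_algebra))"
  by (induction I rule: infinite_finite_induct) (auto simp: star_add)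

lemma star_power: "star (x ^ n) = star (x::'a::unital_cstar_algebra) ^ n"
  by (induction n) (auto simp: star_mult power_commutes)

lemma norm_star [simp]: "norm (star x) = norm (x::'a::unital_cstar_algebra)"
proof -
  have le: "norm y \<le> norm (star y)" for y :: 'a
  proof (cases "norm y = 0")
    case False
    have "norm y * norm y \<le> norm (star y) * norm y"
      using norm_star_mult_self[of y] norm_mult_ineq[of "star y" y]
      by (simp add: power2_eq_square)
    with False show ?thesis by simp
  qed simp
  show ?thesis using le[of x] le[of "star x"] by (simp add: star_star)
qed

lemma star_mult_self_eq_0_iff: "star x * x = 0 \<longleftrightarrow> x = (0::'a::unital_cstar_algebra)"
  using norm_star_mult_self[of x] by auto

lemma mult_star_self_eq_0_iff: "x * star x = 0 \<longleftrightarrow> x = (0::'a::unital_cstar_algebra)"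
  by (metis star_mult_self_eq_0_iff star_star star_zero)

lemma bounded_linear_star: "bounded_linear (star :: 'a::unital_cstar_algebra \<Rightarrow> 'a)"
  by (rule bounded_linear_intro[where K = 1]) (auto simp: star_add star_scaleR)

lemma norm_mult3_ineq: "norm (a * b * c) \<le> norm a * norm b * norm (c::'a::real_normed_algebra)"
  by (rule order_trans[OF norm_mult_ineq mult_right_mono[OF norm_mult_ineq norm_ge_zero]])

text \<open>
  The binomial coefficients of \<open>(1 - x)\<^sup>1\<^sup>/\<^sup>2\<close> are negative after the first, and their partial sums are
  again signed binomial coefficients, which are positive.  So the series converges absolutely even
  on the boundary of the unit disc, and its coefficients after the first have total mass at most 1.
\<close>

lemma summable_gbinomial_half:
  defines "c \<equiv> \<lambda>n. (1/2 gchoose n) * (-1) ^ n :: real"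
  shows "summable (\<lambda>n. \<bar>c n\<bar>)" and "(\<Sum>n. \<bar>c (Suc n)\<bar>) \<le> 1"
proof -
  have neg: "(-1) ^ m * ((-1/2::real) gchoose m) > 0" for m
  proof (induction m)
    case (Suc m)
    have "(real m + 1) * ((-1/2::real) gchoose Suc m) = (- 1/2 - real m) * ((-1/2) gchoose m)"
      using gbinomial_mult_1[of "-1/2::real" m] by (simp add: algebra_simps)
    then have "((-1/2::real) gchoose Suc m) = - ((m + 1/2) / (m + 1)) * ((-1/2) gchoose m)"
      by (simp add: divide_simps) (simp add: algebra_simps)
    then have "(-1) ^ Suc m * ((-1/2::real) gchoose Suc m)
        = ((-1) ^ m * ((-1/2::real) gchoose m)) * ((m + 1/2) / (m + 1))"
      by simp
    also have "\<dots> > 0" by (rule mult_pos_pos[OF Suc]) auto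
    finally show ?case .
  qed simp
  have c_Suc: "c (Suc m) = - (((-1) ^ m * ((-1/2::real) gchoose m)) / (2 * (m + 1)))" for m
    using gbinomial_absorption[of m "1/2::real"] by (simp add: c_def field_simps)
  have c_neg: "c (Suc m) < 0" for m
    unfolding c_Suc using neg[of m] by simp
  have partial: "(\<Sum>k<m. \<bar>c (Suc k)\<bar>) \<le> 1" for m
  proof -
    have "(\<Sum>k\<le>m. (1/2 gchoose k) * (-1) ^ k) = (-1) ^ m * ((1/2 - 1 :: real) gchoose m)"
      by (rule gbinomial_sum_lower_neg)
    then have "(\<Sum>k\<le>m. c k) > 0" using neg[of m] by (simp add: c_def)
    moreover have "(\<Sum>k\<le>m. c k) = c 0 + (\<Sum>k<m. c (Suc k))"
      by (metis lessThan_Suc_atMost sum.lessThan_Suc_shift)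
    moreover have "(\<Sum>k<m. c (Suc k)) = - (\<Sum>k<m. \<bar>c (Suc k)\<bar>)"
      using c_neg by (simp add: sum_negf[symmetric] abs_of_neg)
    moreover have "c 0 = 1" by (simp add: c_def)
    ultimately show ?thesis by linarith
  qed
  have "summable (\<lambda>n. \<bar>c (Suc n)\<bar>)"
    by (rule summableI_nonneg_bounded[where x = 1]) (use partial in auto)
  then show "summable (\<lambda>n. \<bar>c n\<bar>)"
    using summable_Suc_iff[of "\<lambda>n. \<bar>c n\<bar>"] by simp
  show "(\<Sum>n. \<bar>c (Suc n)\<bar>) \<le> 1"
    by (rule suminf_le_const) (use \<open>summable (\<lambda>n. \<bar>c (Suc n)\<bar>)\<close> partial in auto)
qed

text \<open>
  The root is the binomial series, and its square is computed by Vandermonde's identity.  The bound on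
  \<open>1 - s\<close> makes the root itself positive in the sense of \<open>norm_positive\<close> below.
\<close>

lemma selfadjoint_sqrt_one_minus:
  fixes x :: "'a::unital_cstar_algebra"
  assumes "star x = x" and "norm x \<le> 1"
  obtains s where "star s = s" and "s * s = 1 - x" and "norm (1 - s) \<le> 1"
    and "\<And>y. x * y = y * x \<Longrightarrow> s * y = y * s"
proof -
  define c :: "nat \<Rightarrow> real" where "c n = (1/2 gchoose n) * (-1) ^ n" for n
  note c = summable_gbinomial_half[folded c_def]
  define f where "f n = c n *\<^sub>R x ^ n" for n
  have norm_f: "norm (f n) \<le> \<bar>c n\<bar>" for n
  proof -
    have "norm (x ^ n) \<le> 1"
      using norm_power_ineq[of x n] power_le_one[OF norm_ge_zero assms(2), of n] by linarith
    then have "\<bar>c n\<bar> * norm (x ^ n) \<le> \<bar>c n\<bar> * 1" by (intro mult_left_mono) auto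
    then show ?thesis by (simp add: f_def)
  qed
  have abs_f: "summable (\<lambda>n. norm (f n))"
    by (rule summable_comparison_test'[OF c(1), of 0]) (use norm_f in auto)
  have f: "summable f" by (rule summable_norm_cancel[OF abs_f])
  define s where "s = suminf f"
  have "star (f n) = f n" for n by (simp add: f_def star_scaleR star_power assms(1))
  then have "star s = s"
    unfolding s_def bounded_linear.suminf[OF bounded_linear_star f] by simp
  moreover have "s * s = 1 - x"
  proof -
    have "s * s = (\<Sum>n. \<Sum>i\<le>n. f i * f (n - i))"
      unfolding s_def by (rule Cauchy_product[OF abs_f abs_f])
    also have "(\<lambda>n. \<Sum>i\<le>n. f i * f (n - i)) = (\<lambda>n. ((-1) ^ n * (1 gchoose n)) *\<^sub>R x ^ n)"
    proof
      fix n
      have "(\<Sum>i\<le>n. f i * f (n - i)) = (\<Sum>i\<le>n. (c i * c (n - i)) *\<^sub>R x ^ n)"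
        by (rule sum.cong) (auto simp: f_def power_add[symmetric])
      also have "\<dots> = (\<Sum>i\<le>n. c i * c (n - i)) *\<^sub>R x ^ n" by (simp add: scaleR_sum_left)
      also have "(\<Sum>i\<le>n. c i * c (n - i))
          = (-1) ^ n * (\<Sum>i\<le>n. (1/2 gchoose i) * (1/2 gchoose (n - i)))"
        by (simp add: sum_distrib_left c_def, rule sum.cong)
          (auto simp: power_add[symmetric] mult_ac)
      also have "(\<Sum>i\<le>n. (1/2 gchoose i) * (1/2 gchoose (n - i))) = (1::real) gchoose n"
        using gbinomial_Vandermonde[of "1/2::real" "1/2" n] by (simp add: atLeast0AtMost)
      finally show "(\<Sum>i\<le>n. f i * f (n - i)) = ((-1) ^ n * (1 gchoose n)) *\<^sub>R x ^ n" .
    qed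
    also have "(\<Sum>n. ((-1) ^ n * (1 gchoose n)) *\<^sub>R x ^ n)
        = (\<Sum>n\<in>{0, 1}. ((-1) ^ n * (1 gchoose n)) *\<^sub>R x ^ n)"
    proof (rule suminf_finite)
      fix n :: nat assume "n \<notin> {0, 1}"
      then have "1 < n" by auto
      then have "(1::real) gchoose n = 0"
        by (metis binomial_eq_0 binomial_gbinomial of_nat_0 of_nat_1)
      then show "((-1) ^ n * (1 gchoose n)) *\<^sub>R x ^ n = 0" by simp
    qed simp
    also have "\<dots> = 1 - x" by simp
    finally show ?thesis .
  qed
  moreover have "norm (1 - s) \<le> 1"
  proof -
    have s: "s = f 0 + (\<Sum>n. f (Suc n))"
      unfolding s_def using suminf_split_head[OF f] by simp
    have abs_f_Suc: "summable (\<lambda>n. norm (f (Suc n)))"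
      using abs_f by (subst summable_Suc_iff)
    have "norm (1 - s) = norm (\<Sum>n. f (Suc n))" unfolding s by (simp add: f_def c_def)
    also have "\<dots> \<le> (\<Sum>n. norm (f (Suc n)))"
      by (rule summable_norm[OF abs_f_Suc])
    also have "\<dots> \<le> (\<Sum>n. \<bar>c (Suc n)\<bar>)"
    proof (rule suminf_le)
      show "norm (f (Suc n)) \<le> \<bar>c (Suc n)\<bar>" for n by (rule norm_f)
      show "summable (\<lambda>n. norm (f (Suc n)))" by (rule abs_f_Suc)
      show "summable (\<lambda>n. \<bar>c (Suc n)\<bar>)" using c(1) by (subst summable_Suc_iff)
    qed
    finally show ?thesis using c(2) by linarith
  qed
  moreover have "s * y = y * s" if "x * y = y * x" for y
  proof -
    have "s * y = (\<Sum>n. f n * y)" unfolding s_def by (rule suminf_mult2[OF f])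
    also have "\<dots> = (\<Sum>n. y * f n)"
      by (simp add: f_def power_commuting_commutes[OF that])
    also have "\<dots> = y * s" unfolding s_def by (rule suminf_mult[OF f])
    finally show ?thesis .
  qed
  ultimately show ?thesis using that by blast
qed

text \<open>
  The spectrum of a self-adjoint \<open>a\<close> lies in \<open>[0, \<infinity>)\<close> iff \<open>\<parallel>t - a\<parallel> \<le> t\<close> for some
  \<open>t \<ge> 0\<close>.  Used as a definition, this avoids spectra and makes sums of positive elements
  positive at once.
\<close>

definition norm_positive :: "'a::unital_cstar_algebra \<Rightarrow> bool"
  where "norm_positive a \<longleftrightarrow> star a = a \<and> (\<exists>t\<ge>0. norm (t *\<^sub>R 1 - a) \<le> t)"

lemma norm_positive_add:
  assumes "norm_positive a" and "norm_positive b"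
  shows "norm_positive (a + b)"
proof -
  obtain t r where tr: "t \<ge> 0" "norm (t *\<^sub>R 1 - a) \<le> t" "r \<ge> 0" "norm (r *\<^sub>R 1 - b) \<le> r"
    using assms by (auto simp: norm_positive_def)
  have "(t + r) *\<^sub>R 1 - (a + b) = (t *\<^sub>R 1 - a) + (r *\<^sub>R 1 - b)"
    by (simp add: algebra_simps)
  also have "norm \<dots> \<le> norm (t *\<^sub>R 1 - a) + norm (r *\<^sub>R 1 - b)" by (rule norm_triangle_ineq)
  also have "\<dots> \<le> t + r" using tr by simp
  finally have "norm ((t + r) *\<^sub>R 1 - (a + b)) \<le> t + r" .
  then show ?thesis
    using assms tr by (auto simp: norm_positive_def star_add intro!: exI[of _ "t + r"])
qed

lemma norm_positive_scaleR:
  assumes "norm_positive a" and "r \<ge> 0"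
  shows "norm_positive (r *\<^sub>R a)"
proof -
  obtain t where t: "t \<ge> 0" "norm (t *\<^sub>R 1 - a) \<le> t"
    using assms by (auto simp: norm_positive_def)
  have "norm ((r * t) *\<^sub>R 1 - r *\<^sub>R a) = r * norm (t *\<^sub>R 1 - a)"
    using assms(2) by (metis abs_of_nonneg norm_scaleR scaleR_right_diff_distrib scaleR_scaleR)
  also have "\<dots> \<le> r * t" using t assms(2) by (intro mult_left_mono)
  finally show ?thesis
    using assms t by (auto simp: norm_positive_def star_scaleR intro!: exI[of _ "r * t"])
qed

lemma norm_positive_sum:
  "(\<And>i. i \<in> I \<Longrightarrow> norm_positive (f i)) \<Longrightarrow> norm_positive (sum f I)"
proof (induction I rule: infinite_finite_induct)
  case (insert i I)
  then show ?case by (simp add: norm_positive_add)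
qed (auto simp: norm_positive_def)

lemma norm_positive_sqrt:
  fixes a :: "'a::unital_cstar_algebra"
  assumes "norm_positive a"
  obtains s where "star s = s" and "s * s = a" and "norm_positive s"
    and "\<And>y. a * y = y * a \<Longrightarrow> s * y = y * s"
proof -
  obtain t where t: "t \<ge> 0" "norm (t *\<^sub>R 1 - a) \<le> t" and a: "star a = a"
    using assms by (auto simp: norm_positive_def)
  show ?thesis
  proof (cases "t = 0")
    case True
    with t have "a = 0" by simp
    with that[of 0] show ?thesis by (simp add: norm_positive_def exI[of _ 0])
  next
    case False
    with t have t0: "t > 0" by simp
    define x where "x = 1 - (1 / t) *\<^sub>R a"
    have "x = (1 / t) *\<^sub>R (t *\<^sub>R 1 - a)" using t0 by (simp add: x_def scaleR_right_diff_distrib)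
    then have "norm x = norm (t *\<^sub>R 1 - a) / t" using t0 by simp
    then have "norm x \<le> 1" using t t0 by simp
    moreover have "star x = x" by (simp add: x_def star_diff star_scaleR a)
    ultimately obtain s where s: "star s = s" "s * s = 1 - x" "norm (1 - s) \<le> 1"
      "\<And>y. x * y = y * x \<Longrightarrow> s * y = y * s"
      using selfadjoint_sqrt_one_minus by blast
    have "norm_positive s" using s(1,3) by (auto simp: norm_positive_def intro!: exI[of _ 1])
    then have "norm_positive (sqrt t *\<^sub>R s)" using t by (intro norm_positive_scaleR) auto
    moreover have "(sqrt t *\<^sub>R s) * (sqrt t *\<^sub>R s) = a"
    proof -
      have "(sqrt t *\<^sub>R s) * (sqrt t *\<^sub>R s) = (sqrt t * sqrt t) *\<^sub>R (s * s)" by simp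
      also have "\<dots> = t *\<^sub>R ((1 / t) *\<^sub>R a)" using t0 by (simp only: s(2)) (simp add: x_def)
      finally show ?thesis using t0 by simp
    qed
    moreover have "(sqrt t *\<^sub>R s) * y = y * (sqrt t *\<^sub>R s)" if "a * y = y * a" for y
    proof -
      have "x * y = y * x" by (simp add: x_def left_diff_distrib right_diff_distrib that)
      then show ?thesis using s(4) by simp
    qed
    ultimately show ?thesis using that[of "sqrt t *\<^sub>R s"] s(1) by (simp add: star_scaleR)
  qed
qed

text \<open>
  For commuting self-adjoint \<open>x\<close> and \<open>y\<close>, the sum of the squares is \<open>u\<^sup>* u\<close> with
  \<open>u = x + \<i> y\<close>.
\<close>

lemma commuting_squares_add_eq_0:
  fixes x y :: "'a::unital_cstar_algebra"
  assumes "star x = x" and "star y = y" and "x * y = y * x" and "x * x + y * y = 0"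
  shows "x = 0"
proof -
  define u where "u = x + \<i> *\<^sub>C y"
  have su: "star u = x - \<i> *\<^sub>C y"
    by (simp add: u_def star_add star_scaleC assms complex_vector.scale_minus_left)
  have "star u * u = x * x + y * y"
    unfolding su unfolding u_def
    by (simp add: algebra_simps mult_scaleC_left mult_scaleC_right assms(3) scaleC_scaleC
        complex_vector.scale_minus_left)
  with assms(4) have "u = 0" by (simp add: star_mult_self_eq_0_iff)
  moreover from this have "star u = 0" by simp
  ultimately have "u + star u = 0" by simp
  then have "x + x = 0" unfolding su unfolding u_def by simp
  then have "2 *\<^sub>R x = 0" by (simp add: scaleR_2)
  then show "x = 0" by simp
qed

text \<open>
  The roots of \<open>a\<close> and \<open>- a\<close> commute, and their squares add up to 0.
\<close>

lemma norm_positive_antisym: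
  fixes a :: "'a::unital_cstar_algebra"
  assumes "norm_positive a" and "norm_positive (- a)"
  shows "a = 0"
proof -
  obtain s where s: "star s = s" "s * s = a" "\<And>y. a * y = y * a \<Longrightarrow> s * y = y * s"
    using norm_positive_sqrt[OF assms(1)] by metis
  obtain r where r: "star r = r" "r * r = - a" "\<And>y. (- a) * y = y * (- a) \<Longrightarrow> r * y = y * r"
    using norm_positive_sqrt[OF assms(2)] by metis
  have "s * a = a * s" by (metis s(2) mult.assoc)
  then have "s * r = r * s" using r(3)[of s] by simp
  then have "s = 0" using commuting_squares_add_eq_0[of s r] s(1,2) r(1,2) by simp
  then show ?thesis using s(2) by simp
qed

lemma norm_positive_square:
  fixes h :: "'a::unital_cstar_algebra"
  assumes h: "star h = h"
  shows "norm_positive (h * h)"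
proof -
  have unit: "norm_positive (h * h)" if h: "star h = h" and "norm h \<le> 1" for h :: 'a
  proof -
    have "norm (h * h) \<le> 1"
      using norm_mult_ineq[of h h] mult_le_one[of "norm h" "norm h"] that by simp
    then obtain g where g: "star g = g" "g * g = 1 - h * h"
      "\<And>y. (h * h) * y = y * (h * h) \<Longrightarrow> g * y = y * g"
      using selfadjoint_sqrt_one_minus[of "h * h"] h by (metis star_mult)
    have gh: "g * h = h * g" using g(3)[of h] by (simp add: mult.assoc)
    (* u is unitary with imaginary part g, so g has norm at most 1 *)
    define u where "u = h + \<i> *\<^sub>C g"
    have su: "star u = h - \<i> *\<^sub>C g"
      by (simp add: u_def star_add star_scaleC g h complex_vector.scale_minus_left)
    have "star u * u = h * h + g * g"
      unfolding su unfolding u_def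
      by (simp add: algebra_simps mult_scaleC_left mult_scaleC_right gh scaleC_scaleC
          complex_vector.scale_minus_left)
    then have "(norm u)\<^sup>2 = 1" using norm_star_mult_self[of u] g(2) by simp
    then have "norm u = 1" using norm_ge_zero[of u] by (simp add: power2_eq_1_iff)
    have "u - star u = (2 * \<i>) *\<^sub>C g"
      unfolding su unfolding u_def using scaleC_add_left[of \<i> \<i> g] by simp
    then have "2 * norm g = norm (u - star u)" by (simp add: norm_scaleC norm_mult)
    also have "\<dots> \<le> 2" using norm_triangle_ineq4[of u "star u"] \<open>norm u = 1\<close> by simp
    finally have "norm g \<le> 1" by simp
    then have "norm (1 - h * h) \<le> 1"
      using norm_mult_ineq[of g g] mult_le_one[of "norm g" "norm g"] g(2) by simp
    then show ?thesis
      using h by (auto simp: norm_positive_def star_mult intro!: exI[of _ 1])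
  qed
  show ?thesis
  proof (cases "h = 0")
    case False
    define g where "g = (1 / norm h) *\<^sub>R h"
    have "norm_positive (g * g)" using unit[of g] False h by (simp add: g_def star_scaleR)
    then have "norm_positive ((norm h * norm h) *\<^sub>R (g * g))"
      by (rule norm_positive_scaleR) simp
    then show ?thesis using False by (simp add: g_def)
  qed (auto simp: norm_positive_def)
qed

text \<open>
  With \<open>x\<close> and \<open>y\<close> twice the real part and minus twice the imaginary part of \<open>c\<close>, the element is half
  the sum of their squares.
\<close>

lemma norm_positive_star_mult_add_mult_star:
  fixes c :: "'a::unital_cstar_algebra"
  shows "norm_positive (star c * c + c * star c)"
proof -
  define x where "x = c + star c"
  define y where "y = \<i> *\<^sub>C (c - star c)"
  have "star x = x" by (simp add: x_def star_add star_star add.commute)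
  moreover have "star y = y"
    by (simp add: y_def star_scaleC star_diff star_star algebra_simps
        complex_vector.scale_minus_left complex_vector.scale_right_diff_distrib)
  ultimately have "norm_positive ((1/2) *\<^sub>R (x * x + y * y))"
    by (intro norm_positive_scaleR norm_positive_add norm_positive_square) auto
  moreover have "x * x + y * y = 2 *\<^sub>R (star c * c + c * star c)"
    by (simp add: x_def y_def mult_scaleC_left mult_scaleC_right scaleC_scaleC scaleR_2
        complex_vector.scale_minus_left algebra_simps)
  ultimately show ?thesis by simp
qed

text \<open>
  Usually one compares the spectra of \<open>c\<^sup>* c\<close> and \<open>c c\<^sup>*\<close>.  Instead, let \<open>s\<close> be a self-adjoint root
  of \<open>- c\<^sup>* c\<close> and \<open>d = c s\<close>.  Then \<open>d\<^sup>* d = - s\<^sup>4\<close> and \<open>d d\<^sup>* = - (c c\<^sup>*)\<^sup>2\<close> are both negative, while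
  their sum is positive.
\<close>

lemma norm_positive_minus_star_mult_self_imp_0:
  fixes c :: "'a::unital_cstar_algebra"
  assumes "norm_positive (- (star c * c))"
  shows "c = 0"
proof -
  obtain s where s: "star s = s" "s * s = - (star c * c)"
    using norm_positive_sqrt[OF assms] by metis
  define d where "d = c * s"
  have dd: "star d * d = - ((s * s) * (s * s))"
  proof -
    have "star d * d = s * (star c * c) * s" by (simp add: d_def star_mult s mult.assoc)
    also have "star c * c = - (s * s)" using s by simp
    finally show ?thesis by (simp add: mult.assoc)
  qed
  have dd': "d * star d = - ((c * star c) * (c * star c))"
  proof -
    have "d * star d = c * (s * s) * star c" by (simp add: d_def star_mult s(1) mult.assoc)
    also have "\<dots> = c * (- (star c * c)) * star c" by (simp only: s(2))
    finally show ?thesis by (simp add: mult.assoc)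
  qed
  have ss: "norm_positive ((s * s) * (s * s))"
    by (rule norm_positive_square) (simp add: star_mult s(1))
  have cc: "norm_positive ((c * star c) * (c * star c))"
    by (rule norm_positive_square) (simp only: star_mult star_star)
  have "norm_positive ((star d * d + d * star d) + (c * star c) * (c * star c))"
    by (rule norm_positive_add[OF norm_positive_star_mult_add_mult_star cc])
  then have "norm_positive (- ((s * s) * (s * s)))" by (simp add: dd dd')
  then have "(s * s) * (s * s) = 0" by (rule norm_positive_antisym[OF ss])
  then have "star (s * s) * (s * s) = 0" by (simp only: star_mult s(1))
  then have "s * s = 0" by (simp only: star_mult_self_eq_0_iff)
  then show ?thesis using s by (simp add: star_mult_self_eq_0_iff)
qed

text \<open>
  Let \<open>h = b\<^sup>* b\<close>, \<open>m = \<bar>h\<bar>\<close> and let \<open>n = m - h\<close> be twice the negative part of \<open>h\<close>.  Since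
  \<open>h n = - m n\<close>, the element \<open>c = b n\<close> has \<open>c\<^sup>* c = - n m n\<close>, which is negative.  So \<open>c = 0\<close>, whence
  \<open>n = 0\<close> and \<open>h = m\<close>.
\<close>

lemma norm_positive_star_mult_self:
  fixes b :: "'a::unital_cstar_algebra"
  shows "norm_positive (star b * b)"
proof -
  define h where "h = star b * b"
  have h: "star h = h" by (simp add: h_def star_mult star_star)
  obtain m where m: "star m = m" "m * m = h * h" "norm_positive m"
    "\<And>y. (h * h) * y = y * (h * h) \<Longrightarrow> m * y = y * m"
    using norm_positive_sqrt[OF norm_positive_square[OF h]] by metis
  have mh: "m * h = h * m" using m(4)[of h] by (simp add: mult.assoc)
  obtain r where r: "star r = r" "r * r = m" "\<And>y. m * y = y * m \<Longrightarrow> r * y = y * r"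
    using norm_positive_sqrt[OF m(3)] by metis
  define n where "n = m - h"
  have n: "star n = n" by (simp add: n_def star_diff m h)
  have rn: "r * n = n * r" by (rule r(3)) (simp add: n_def algebra_simps mh)
  have hn: "h * n = - (m * n)" by (simp add: n_def algebra_simps mh m)
  define c where "c = b * n"
  have "star c * c = n * (h * n)" by (simp add: c_def h_def star_mult n mult.assoc)
  also have "\<dots> = - (n * (r * r) * n)" by (simp add: hn r mult.assoc)
  also have "n * (r * r) * n = (r * n) * (r * n)" by (metis rn mult.assoc)
  finally have "- (star c * c) = (r * n) * (r * n)" by simp
  moreover have "norm_positive ((r * n) * (r * n))"
    by (rule norm_positive_square) (simp add: star_mult n r rn)
  ultimately have "c = 0" using norm_positive_minus_star_mult_self_imp_0 by metis
  then have "h * n = 0" by (simp add: h_def c_def mult.assoc)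
  then have "star n * n = 0" using hn by (simp add: n) (simp add: n_def algebra_simps)
  then have "h = m" by (simp add: star_mult_self_eq_0_iff n_def)
  then show ?thesis using m(3) by (simp add: h_def)
qed

lemma sum_mult_star_self_eq_0:
  fixes f :: "'i \<Rightarrow> 'a::unital_cstar_algebra"
  assumes "finite I" and "(\<Sum>i\<in>I. f i * star (f i)) = 0" and "j \<in> I"
  shows "f j = 0"
proof -
  have pos: "norm_positive (f i * star (f i))" for i
    using norm_positive_star_mult_self[of "star (f i)"] by (simp add: star_star)
  have "- (f j * star (f j)) = (\<Sum>i\<in>I - {j}. f i * star (f i))"
    using assms(2) unfolding sum.remove[OF assms(1,3)] by (rule minus_unique)
  then have "norm_positive (- (f j * star (f j)))" by (simp add: norm_positive_sum pos)
  then have "f j * star (f j) = 0" by (rule norm_positive_antisym[OF pos])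
  then show ?thesis by (simp only: mult_star_self_eq_0_iff)
qed

lemma cstar_positiveI: "cstar_positive (star b * b)"
  by (auto simp: cstar_positive_def)

lemma cstar_positiveE:
  assumes "cstar_positive a"
  obtains b where "a = star b * b"
  using assms unfolding cstar_positive_def by blast


section \<open>Linear maps, dense ideals and spans of inner products\<close>

lemma clinear_on_subset: "clinear_on V f \<Longrightarrow> U \<subseteq> V \<Longrightarrow> clinear_on U f"
  unfolding clinear_on_def by blast

lemma clinear_on_compose:
  "clinear_on UNIV f \<Longrightarrow> clinear_on UNIV g \<Longrightarrow> clinear_on UNIV (\<lambda>x. f (g x))"
  by (auto simp: clinear_on_def)

lemma clinear_on_mult_left: "clinear_on UNIV (\<lambda>x. c * x :: 'a::unital_cstar_algebra)"
  by (auto simp: clinear_on_def algebra_simps mult_scaleC_right)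

lemma clinear_on_mult_right: "clinear_on UNIV (\<lambda>x. x * c :: 'a::unital_cstar_algebra)"
  by (auto simp: clinear_on_def algebra_simps mult_scaleC_left)

context
  fixes f :: "'v::complex_vector \<Rightarrow> 'w::complex_vector"
  assumes f: "clinear_on UNIV f"
begin

lemma clinear_add: "f (x + y) = f x + f y"
  and clinear_scaleC: "f (z *\<^sub>C x) = z *\<^sub>C f x"
  using f by (auto simp: clinear_on_def)

lemma clinear_scaleR: "f (r *\<^sub>R x) = r *\<^sub>R f x"
  by (simp add: scaleR_scaleC clinear_scaleC)

lemma clinear_zero: "f 0 = 0"
  using clinear_scaleC[of 0 0] by simp

lemma clinear_diff: "f (x - y) = f x - f y"
  using clinear_add[of "x - y" y] by simp

lemma clinear_sum: "f (sum g I) = (\<Sum>i\<in>I. f (g i))"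
  by (induction I rule: infinite_finite_induct) (auto simp: clinear_zero clinear_add)

end

lemma clinear_on_sum:
  "(\<And>i. clinear_on UNIV (f i)) \<Longrightarrow> clinear_on UNIV (\<lambda>x. \<Sum>i\<in>I. f i x)"
  by (simp add: clinear_on_def sum.distrib complex_vector.scale_sum_right)

lemma subspace_clinear_vimage:
  "clinear_on UNIV f \<Longrightarrow> csubspace S \<Longrightarrow> csubspace {x. f x \<in> S}"
  by (auto simp: complex_vector.subspace_def clinear_add clinear_scaleC clinear_zero)

lemma clinear_span_subset:
  assumes "clinear_on UNIV f" and "csubspace S" and "\<And>x. x \<in> G \<Longrightarrow> f x \<in> S" and "x \<in> cspan G"
  shows "f x \<in> S"
proof -
  have "cspan G \<subseteq> {x. f x \<in> S}"
    using assms(3) by (intro complex_vector.span_minimal subspace_clinear_vimage assms(1,2)) auto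
  with assms(4) show ?thesis by auto
qed

lemma clinear_eq_on_span:
  assumes f: "clinear_on UNIV f" and g: "clinear_on UNIV g"
    and "\<And>x. x \<in> G \<Longrightarrow> f x = g x" and "x \<in> cspan G"
  shows "f x = g x"
proof -
  have "csubspace {x. f x = g x}"
    using f g by (auto simp: complex_vector.subspace_def clinear_add clinear_scaleC clinear_zero)
  then have "cspan G \<subseteq> {x. f x = g x}"
    using assms(3) by (intro complex_vector.span_minimal) auto
  with assms(4) show ?thesis by auto
qed

text \<open>
  The set meets the ball of radius 1 about the unit, whose elements are invertible by the Neumann
  series, with inverse in the closed algebra.
\<close>

lemma dense_left_ideal_contains_one:
  fixes A S :: "'a::unital_cstar_algebra set"
  assumes A: "unital_cstar_subalgebra A" and "closure S = A"
    and ideal: "\<And>a s. a \<in> A \<Longrightarrow> s \<in> S \<Longrightarrow> a * s \<in> S"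
  shows "1 \<in> S"
proof -
  have cl: "closed A" and sub: "csubspace A" and one: "1 \<in> A"
    and mult: "\<And>a b. a \<in> A \<Longrightarrow> b \<in> A \<Longrightarrow> a * b \<in> A"
    using A by (auto simp: unital_cstar_subalgebra_def)
  obtain s where s: "s \<in> S" "dist s 1 < 1"
    using one assms(2) by (metis closure_approachable zero_less_one)
  define x where "x = 1 - s"
  have "norm x < 1" using s by (simp add: x_def dist_norm norm_minus_commute)
  then have sm: "summable (\<lambda>n. x ^ n)" by (rule complete_algebra_summable_geometric)
  define t where "t = (\<Sum>n. x ^ n)"
  have "t = 1 + (\<Sum>n. x ^ Suc n)"
    unfolding t_def using suminf_split_head[OF sm] by simp
  also have "(\<Sum>n. x ^ Suc n) = t * x"
    unfolding t_def suminf_mult2[OF sm] by (simp add: power_commutes)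
  finally have ts: "t * s = 1" by (simp add: x_def algebra_simps)
  have "s \<in> A" using s(1) assms(2) closure_subset by blast
  then have "x \<in> A" unfolding x_def using sub one by (simp add: complex_vector.subspace_diff)
  then have "x ^ n \<in> A" for n by (induction n) (auto simp: one mult)
  then have "(\<Sum>i<n. x ^ i) \<in> A" for n by (intro complex_vector.subspace_sum sub) auto
  moreover have "(\<lambda>n. \<Sum>i<n. x ^ i) \<longlonglongrightarrow> t"
    unfolding t_def by (rule summable_LIMSEQ[OF sm])
  ultimately have "t \<in> A" using closed_sequentially[OF cl, of "\<lambda>n. \<Sum>i<n. x ^ i"] by blast
  then show ?thesis using ideal s(1) ts by metis
qed


lemma mem_ip_span: "x \<in> U \<Longrightarrow> y \<in> V \<Longrightarrow> ip x y \<in> ip_span ip U V"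
  unfolding ip_span_def by (rule complex_vector.span_base) blast

lemma ip_span_mult_left:
  fixes c :: "'c::unital_cstar_algebra"
  assumes "\<And>x y. x \<in> U \<Longrightarrow> y \<in> V \<Longrightarrow> \<exists>x'\<in>U. \<exists>y'\<in>V. c * ip x y = ip x' y'"
    and "s \<in> ip_span ip U V"
  shows "c * s \<in> ip_span ip U V"
proof (rule clinear_span_subset[OF clinear_on_mult_left _ _ assms(2)[unfolded ip_span_def]])
  fix s assume "s \<in> {ip x y |x y. x \<in> U \<and> y \<in> V}"
  then obtain x y where "s = ip x y" "x \<in> U" "y \<in> V" by blast
  with assms(1) obtain x' y' where "c * s = ip x' y'" "x' \<in> U" "y' \<in> V" by metis
  then show "c * s \<in> ip_span ip U V" by (simp add: mem_ip_span)
qed (simp add: ip_span_def)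


lemma closure_ip_span_eq:
  fixes ip :: "'y \<Rightarrow> 'y \<Rightarrow> 'c::unital_cstar_algebra"
  assumes R: "unital_cstar_subalgebra R" and one: "1 \<in> ip_span ip U V"
    and mem: "\<And>x y. x \<in> U \<Longrightarrow> y \<in> V \<Longrightarrow> ip x y \<in> R"
    and act: "\<And>a x y. a \<in> R \<Longrightarrow> x \<in> U \<Longrightarrow> y \<in> V \<Longrightarrow> \<exists>x'\<in>U. \<exists>y'\<in>V. a * ip x y = ip x' y'"
  shows "closure (ip_span ip U V) = R"
proof
  have "ip_span ip U V \<subseteq> R"
    unfolding ip_span_def
    by (rule complex_vector.span_minimal) (use R mem in \<open>auto simp: unital_cstar_subalgebra_def\<close>)
  then show "closure (ip_span ip U V) \<subseteq> R"
    using R by (simp add: unital_cstar_subalgebra_def closure_minimal)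
  have "a * 1 \<in> ip_span ip U V" if "a \<in> R" for a
    by (rule ip_span_mult_left[OF act[OF that] one])
  then show "R \<subseteq> closure (ip_span ip U V)" using closure_subset by fastforce
qed


section \<open>Projections with expectation equal to the inverse index\<close>

text \<open>
  Expand each \<open>u\<^sub>i\<^sup>*\<close> in the second quasi-basis, exchange the sums and contract with the first one.
  The same exchange yields the centrality of the index and, across the bimodule, the equality of the
  two index actions.
\<close>

lemma quasi_basis_index_unique:
  assumes u: "quasi_basis UNIV E n u" and v: "quasi_basis UNIV E m v"
  shows "(\<Sum>i<n. u i * star (u i)) = (\<Sum>j<m. v j * star (v j))"
proof -
  have "(\<Sum>i<n. u i * star (u i))
      = (\<Sum>i<n. u i * (\<Sum>j<m. E (star (u i) * v j) * star (v j)))"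
    using v by (simp add: quasi_basis_def)
  also have "\<dots> = (\<Sum>j<m. (\<Sum>i<n. u i * E (star (u i) * v j)) * star (v j))"
    by (simp add: sum_distrib_left sum_distrib_right mult.assoc) (rule sum.swap)
  also have "\<dots> = (\<Sum>j<m. v j * star (v j))"
    using u by (simp add: quasi_basis_def)
  finally show ?thesis .
qed

lemma Ind_W_eq:
  assumes "quasi_basis UNIV E n u"
  shows "Ind_W UNIV E = (\<Sum>i<n. u i * star (u i))"
  unfolding Ind_W_def
proof (rule the_equality)
  show "\<exists>m v. quasi_basis UNIV E m v \<and> (\<Sum>i<n. u i * star (u i)) = (\<Sum>i<m. v i * star (v i))"
    using assms by blast
qed (use quasi_basis_index_unique[OF _ assms] in blast)

lemma quasi_basisD:
  assumes "quasi_basis UNIV E n u"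
  shows "(\<Sum>i<n. u i * E (star (u i) * c)) = c"
    and "(\<Sum>i<n. E (c * u i) * star (u i)) = c"
    and "Ind_W UNIV E = (\<Sum>i<n. u i * star (u i))"
  using assms Ind_W_eq[OF assms] unfolding quasi_basis_def by (metis UNIV_I)+

locale finite_index_expectation =
  fixes A :: "'a::unital_cstar_algebra set" and E :: "'a \<Rightarrow> 'a"
  assumes expectation: "conditional_expectation A UNIV E"
    and finite_index: "index_finite_type UNIV E"
begin

lemma E_clinear: "clinear_on UNIV E"
  and E_mem: "E c \<in> A"
  and E_mult_left: "a \<in> A \<Longrightarrow> E (a * c) = a * E c"
  and E_mult_right: "a \<in> A \<Longrightarrow> E (c * a) = E c * a"
  and E_positive: "cstar_positive c \<Longrightarrow> cstar_positive (E c)"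
  and A_subalgebra: "unital_cstar_subalgebra A"
proof -
  note e = expectation[unfolded conditional_expectation_def unital_inclusion_def]
  show "clinear_on UNIV E" "unital_cstar_subalgebra A" using e by blast+
  show "E c \<in> A" using e by blast
  show "a \<in> A \<Longrightarrow> E (a * c) = a * E c" "a \<in> A \<Longrightarrow> E (c * a) = E c * a" using e by (metis UNIV_I)+
  show "cstar_positive c \<Longrightarrow> cstar_positive (E c)" using e by (metis UNIV_I)
qed

lemma A_subspace: "csubspace A" and A_closed: "closed A" and A_one: "1 \<in> A"
  and A_star: "a \<in> A \<Longrightarrow> star a \<in> A" and A_mult: "a \<in> A \<Longrightarrow> b \<in> A \<Longrightarrow> a * b \<in> A"
  using A_subalgebra by (auto simp: unital_cstar_subalgebra_def)

lemmas E_add = clinear_add[OF E_clinear]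
  and E_diff = clinear_diff[OF E_clinear]
  and E_scaleC = clinear_scaleC[OF E_clinear]
  and E_scaleR = clinear_scaleR[OF E_clinear]

lemma E_star: "E (star c) = star (E c)"
proof -
  have pos: "star (E (star b * b)) = E (star b * b)" for b
  proof -
    obtain d where "E (star b * b) = star d * d"
      using E_positive[of "star b * b"] by (auto simp: cstar_positive_def)
    then show ?thesis by (simp add: star_mult star_star)
  qed
  have sa: "star (E h) = E h" if h: "star h = h" for h
  proof -
    (* polarization: a self-adjoint element is a difference of positive ones *)
    have "4 *\<^sub>R h = star (1 + h) * (1 + h) - star (1 - h) * (1 - h)"
      by (simp add: h star_add star_diff algebra_simps)
        (metis add.assoc numeral_Bit0 scaleR_2 scaleR_left_distrib)
    then have "4 *\<^sub>R E h = E (star (1 + h) * (1 + h)) - E (star (1 - h) * (1 - h))"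
      by (metis E_diff E_scaleR)
    then have "star (4 *\<^sub>R E h) = 4 *\<^sub>R E h" by (metis pos star_diff)
    then show ?thesis by (simp add: star_scaleR)
  qed
  define x where "x = c + star c"
  define y where "y = \<i> *\<^sub>C (c - star c)"
  have x: "star x = x" by (simp add: x_def star_add star_star add.commute)
  have y: "star y = y"
    by (simp add: y_def star_scaleC star_diff star_star algebra_simps
        complex_vector.scale_minus_left complex_vector.scale_right_diff_distrib)
  have iy: "\<i> *\<^sub>C y = star c - c"
    by (simp add: y_def scaleC_scaleC complex_vector.scale_minus_left)
  have "2 *\<^sub>R c = x - \<i> *\<^sub>C y" unfolding iy by (simp add: x_def scaleR_2)
  then have "2 *\<^sub>R E c = E x - \<i> *\<^sub>C E y" by (metis E_diff E_scaleC E_scaleR)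
  then have "2 *\<^sub>R star (E c) = star (E x - \<i> *\<^sub>C E y)" by (metis star_scaleR)
  also have "\<dots> = E x + \<i> *\<^sub>C E y"
    by (simp add: star_diff star_scaleC sa x y complex_vector.scale_minus_left)
  also have "\<dots> = E (x + \<i> *\<^sub>C y)" by (simp add: E_add E_scaleC)
  also have "x + \<i> *\<^sub>C y = 2 *\<^sub>R star c" unfolding iy by (simp add: x_def scaleR_2)
  finally show ?thesis by (simp add: E_scaleR)
qed

abbreviation k :: 'a where "k \<equiv> Ind_W UNIV E"

lemma index_central: "k * c = c * k"
proof -
  obtain n u where "quasi_basis UNIV E n u"
    using finite_index by (auto simp: index_finite_type_def)
  note u = quasi_basisD[OF this]
  have "c * k = (\<Sum>i<n. (c * u i) * star (u i))"
    by (simp add: u(3) sum_distrib_left mult.assoc)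
  also have "\<dots> = (\<Sum>i<n. (\<Sum>j<n. u j * E (star (u j) * (c * u i))) * star (u i))"
    by (simp only: u(1))
  also have "\<dots> = (\<Sum>j<n. u j * (\<Sum>i<n. E ((star (u j) * c) * u i) * star (u i)))"
    by (simp add: sum_distrib_left sum_distrib_right mult.assoc) (rule sum.swap)
  also have "\<dots> = k * c" by (simp only: u(2)) (simp add: u(3) sum_distrib_right mult.assoc)
  finally show ?thesis by simp
qed

lemma index_left_commute: "c * (k * d) = k * (c * d)"
  by (metis index_central mult.assoc)

lemma index_star: "star k = k"
proof -
  obtain n u where "quasi_basis UNIV E n u"
    using finite_index by (auto simp: index_finite_type_def)
  then show ?thesis by (simp add: quasi_basisD(3) star_sum star_mult star_star)
qed

end

text \<open>
  Such a projection is the Jones projection of a smaller inclusion: it presents the whole algebra as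
  the basic construction of \<open>P \<subseteq> A\<close>, where \<open>P\<close> is the part of \<open>A\<close> that commutes with \<open>p\<close>.
\<close>

locale index_projection = finite_index_expectation A E
  for A :: "'a::unital_cstar_algebra set" and E :: "'a \<Rightarrow> 'a" +
  fixes p :: 'a
  assumes index_mem: "Ind_W UNIV E \<in> A"
    and projection: "full_projection UNIV p"
    and E_p_index: "E p * Ind_W UNIV E = 1"
begin

lemma p_star: "star p = p" and p_idem: "p * p = p"
  using projection by (auto simp: full_projection_def)

lemma p_absorb: "p * (p * c) = p * c"
  by (simp add: p_idem flip: mult.assoc)

lemma index_E_p: "k * E p = 1"
  by (simp add: index_central E_p_index)

lemma E_index_mult: "E (k * c) = k * E c"
  using index_mem by (rule E_mult_left)

text \<open>
  Let \<open>T c = p c - k p E(p c)\<close>.  With respect to the \<open>A\<close>-valued inner product \<open>E(x\<^sup>* y)\<close> this is the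
  projection \<open>p - k p e p\<close>, where \<open>e\<close> is \<open>E\<close> as an operator.  The sum of \<open>T(u\<^sub>i) u\<^sub>i\<^sup>*\<close> over a
  quasi-basis is, up to the factor \<open>k\<close>, the dual conditional expectation of \<open>T\<close>, and it
  vanishes.  Because \<open>T\<close> is a projection, it also equals the sum of \<open>T(u\<^sub>i) T(u\<^sub>i)\<^sup>*\<close>, so that \<open>T\<close> kills
  the quasi-basis.
\<close>

lemma p_mult_eq: "p * c = k * (p * E (p * c))"
proof -
  obtain n u where "quasi_basis UNIV E n u"
    using finite_index by (auto simp: index_finite_type_def)
  note u = quasi_basisD[OF this]
  define T where "T c = p * c - k * (p * E (p * c))" for c
  have T_clinear: "clinear_on UNIV T"
    by (simp add: clinear_on_def T_def E_add E_scaleC algebra_simps mult_scaleC_left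
        mult_scaleC_right complex_vector.scale_right_diff_distrib)
  have T_mult: "T (c * a) = T c * a" if "a \<in> A" for c a
    using E_mult_right[OF that, of "p * c"] by (simp add: T_def algebra_simps)
  have T_expand: "T c = (\<Sum>j<n. T (u j) * E (star (u j) * c))" for c
    by (subst u(1)[of c, symmetric]) (simp only: clinear_sum[OF T_clinear] T_mult[OF E_mem])
  have E_p_T: "E (p * T c) = 0" for c
  proof -
    have "p * T c = p * c - k * (p * E (p * c))"
      by (simp add: T_def right_diff_distrib p_absorb) (metis index_central mult.assoc p_idem)
    then have "E (p * T c) = E (p * c) - (k * E p) * E (p * c)"
      by (simp add: E_diff E_index_mult E_mult_right[OF E_mem] mult.assoc)
    then show ?thesis by (simp add: index_E_p)
  qed
  have T_idem: "T (T c) = T c" for c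
  proof -
    have "T (T c) = p * T c" by (subst T_def) (simp add: E_p_T)
    also have "\<dots> = T c"
      by (simp add: T_def right_diff_distrib p_absorb) (metis index_central mult.assoc p_idem)
    finally show ?thesis .
  qed
  have T_adjoint: "E (star (T x) * y) = E (star x * T y)" for x y
  proof -
    have "star (T x) = star x * p - E (star x * p) * (p * k)"
      by (simp add: T_def star_diff star_mult p_star index_star mult.assoc flip: E_star)
    then have "E (star (T x) * y) = E (star x * p * y) - E (star x * p) * E (k * (p * y))"
      by (simp add: left_diff_distrib E_diff E_mult_left[OF E_mem] mult.assoc index_central)
    also have "\<dots> = E (star x * p * y) - k * (E (star x * p) * E (p * y))"
      by (simp add: E_index_mult) (metis index_central mult.assoc)
    also have "\<dots> = E (star x * p * y) - E (k * (star x * p * E (p * y)))"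
      by (simp add: E_index_mult E_mult_right[OF E_mem])
    also have "k * (star x * p * E (p * y)) = star x * (k * (p * E (p * y)))"
      by (metis index_central mult.assoc)
    finally show ?thesis by (simp add: T_def right_diff_distrib E_diff mult.assoc)
  qed
  have trace: "(\<Sum>i<n. T (u i) * star (u i)) = 0"
  proof -
    have "(\<Sum>i<n. T (u i) * star (u i))
        = p * (\<Sum>i<n. u i * star (u i)) - k * (p * (\<Sum>i<n. E (p * u i) * star (u i)))"
      by (simp add: T_def left_diff_distrib sum_subtractf sum_distrib_left mult.assoc)
    also have "\<dots> = 0" by (simp add: u(2) p_idem index_central flip: u(3))
    finally show ?thesis .
  qed
  have "(\<Sum>j<n. T (u j) * star (T (u j)))
      = (\<Sum>j<n. T (u j) * (\<Sum>i<n. E (star (u j) * T (u i)) * star (u i)))"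
    by (simp only: u(2) flip: T_adjoint)
  also have "\<dots> = (\<Sum>i<n. (\<Sum>j<n. T (u j) * E (star (u j) * T (u i))) * star (u i))"
    by (simp add: sum_distrib_left sum_distrib_right mult.assoc) (rule sum.swap)
  also have "\<dots> = (\<Sum>i<n. T (u i) * star (u i))"
    by (simp only: T_idem flip: T_expand)
  finally have "(\<Sum>j<n. T (u j) * star (T (u j))) = 0" by (simp only: trace)
  then have "T (u j) = 0" if "j < n" for j
    using sum_mult_star_self_eq_0[of "{..<n}" "\<lambda>j. T (u j)" j] that by simp
  then have "T c = 0" by (subst T_expand) simp
  then show ?thesis by (simp add: T_def)
qed

lemma mult_p_eq: "c * p = k * (E (c * p) * p)"
proof -
  have "c * p = star (p * star c)" by (simp add: star_mult star_star p_star)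
  also have "\<dots> = star (k * (p * E (p * star c)))" by (subst p_mult_eq) simp
  also have "\<dots> = E (c * p) * p * k"
    by (simp add: star_mult star_star p_star index_star flip: E_star)
  finally show ?thesis by (simp add: index_central)
qed

text \<open>
  By the two preceding identities \<open>a p b = (k E(a p)) p (k E(p b))\<close>, so the fullness of \<open>p\<close> needs
  coefficients from \<open>A\<close> only.
\<close>

lemma one_mem_span_A_p_A: "1 \<in> cspan {a * p * b |a b. a \<in> A \<and> b \<in> A}" (is "_ \<in> cspan ?G")
proof -
  have "{a * p * b |a b. a \<in> UNIV \<and> b \<in> UNIV} \<subseteq> ?G"
  proof clarify
    fix a b
    have "a * p * b = (a * p) * (p * b)" by (simp add: mult.assoc p_absorb)
    also have "\<dots> = (k * (E (a * p) * p)) * (k * (p * E (p * b)))"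
      by (rule arg_cong2[where f = "(*)", OF mult_p_eq p_mult_eq])
    also have "\<dots> = (k * E (a * p)) * p * (k * E (p * b))"
      by (simp add: mult.assoc index_left_commute[of p] p_absorb)
    finally have "a * p * b = (k * E (a * p)) * p * (k * E (p * b))" .
    moreover have "k * E (a * p) \<in> A" "k * E (p * b) \<in> A"
      by (simp_all add: A_mult index_mem E_mem)
    ultimately show "\<exists>a' b'. a * p * b = a' * p * b' \<and> a' \<in> A \<and> b' \<in> A" by metis
  qed
  then have "cspan {a * p * b |a b. a \<in> UNIV \<and> b \<in> UNIV} \<subseteq> cspan ?G"
    by (rule complex_vector.span_mono)
  moreover have "cspan {a * p * b |a b. a \<in> UNIV \<and> b \<in> UNIV} = UNIV"
    using projection by (simp add: full_projection_def)
  ultimately show ?thesis by blast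
qed

definition P :: "'a set" where "P = {a \<in> A. p * a = a * p}"

definition E_P :: "'a \<Rightarrow> 'a" where "E_P a = k * E (p * a * p)"

lemma compress_eq_E_P_p: "p * a * p = E_P a * p"
  using mult_p_eq[of "p * a"] by (simp add: E_P_def mult.assoc)

lemma compress_eq_p_E_P: "p * a * p = p * E_P a"
  using p_mult_eq[of "a * p"] unfolding E_P_def by (metis index_central mult.assoc)

lemma E_P_mem: "E_P a \<in> P"
proof -
  have "E_P a \<in> A" unfolding E_P_def by (intro A_mult index_mem E_mem)
  then show ?thesis
    unfolding P_def by (simp flip: compress_eq_E_P_p compress_eq_p_E_P)
qed

lemma E_P_id: "a \<in> P \<Longrightarrow> E_P a = a"
proof -
  assume "a \<in> P"
  then have a: "a \<in> A" "p * a = a * p" by (auto simp: P_def)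
  have "p * a * p = a * p" by (simp add: a mult.assoc p_idem)
  then have "E_P a = k * (a * E p)" using a by (simp add: E_P_def E_mult_left)
  also have "\<dots> = a * (k * E p)" by (metis index_central mult.assoc)
  finally show ?thesis by (simp add: index_E_p)
qed

lemma E_P_clinear: "clinear_on UNIV E_P"
  by (simp add: clinear_on_def E_P_def E_add E_scaleC algebra_simps mult_scaleC_left
        mult_scaleC_right)

lemma E_P_mult_left: "a \<in> P \<Longrightarrow> E_P (a * c) = a * E_P c"
proof -
  assume "a \<in> P"
  then have a: "a \<in> A" "p * a = a * p" by (auto simp: P_def)
  have "p * (a * c) * p = a * (p * c * p)" by (metis a(2) mult.assoc)
  then have "E_P (a * c) = k * (a * E (p * c * p))" using a by (simp add: E_P_def E_mult_left)
  also have "\<dots> = a * E_P c" unfolding E_P_def by (metis index_central mult.assoc)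
  finally show ?thesis .
qed

lemma E_P_mult_right: "a \<in> P \<Longrightarrow> E_P (c * a) = E_P c * a"
proof -
  assume "a \<in> P"
  then have a: "a \<in> A" "p * a = a * p" by (auto simp: P_def)
  have "p * (c * a) * p = (p * c * p) * a" by (metis a(2) mult.assoc)
  then have "E_P (c * a) = k * (E (p * c * p) * a)"
    unfolding E_P_def by (simp only: E_mult_right[OF a(1)])
  then show ?thesis by (simp add: E_P_def mult.assoc)
qed

text \<open>
  \<open>k\<close> is the inverse of the positive element \<open>E p\<close>, and \<open>k = k (E p) k\<close>.
\<close>

lemma index_cstar_positive: "cstar_positive k"
proof -
  have "cstar_positive (E (star p * p))" by (intro E_positive cstar_positiveI)
  then obtain d where d: "E p = star d * d" unfolding p_star p_idem by (rule cstar_positiveE)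
  have "star (d * k) * (d * k) = k * E p * k" by (simp add: d star_mult index_star mult.assoc)
  then have "star (d * k) * (d * k) = k" by (simp only: index_E_p mult_1_left)
  with cstar_positiveI[of "d * k"] show ?thesis by metis
qed

lemma E_P_positive: "cstar_positive a \<Longrightarrow> cstar_positive (E_P a)"
proof -
  assume "cstar_positive a"
  then obtain b where "a = star b * b" by (rule cstar_positiveE)
  then have "p * a * p = star (b * p) * (b * p)" by (simp only: star_mult p_star mult.assoc)
  then have "cstar_positive (E (p * a * p))" using E_positive cstar_positiveI by metis
  then obtain d where d: "E (p * a * p) = star d * d" by (rule cstar_positiveE)
  obtain g where g: "k = star g * g" by (rule cstar_positiveE[OF index_cstar_positive])
  have "E_P a = star d * (k * d)" unfolding E_P_def d by (rule index_left_commute[symmetric])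
  also have "\<dots> = star (g * d) * (g * d)" by (simp only: g star_mult mult.assoc)
  finally show ?thesis by (simp only: cstar_positiveI)
qed

lemma P_subalgebra: "unital_cstar_subalgebra P"
proof -
  have comm: "p * star a = star a * p" if "p * a = a * p" for a
    by (metis p_star star_mult that)
  have "closed ({a. p * a = a * p} \<inter> A)"
    by (intro closed_Int closed_Collect_eq continuous_intros A_closed)
  moreover have "{a. p * a = a * p} \<inter> A = P" by (auto simp: P_def)
  moreover have "csubspace P"
    using A_subspace
    by (auto simp: complex_vector.subspace_def P_def algebra_simps mult_scaleC_left mult_scaleC_right)
  moreover have "p * (a * b) = a * b * p" if "p * a = a * p" "p * b = b * p" for a b
    by (metis mult.assoc that)
  ultimately show ?thesis
    unfolding unital_cstar_subalgebra_def
    by (auto simp: P_def A_one A_star A_mult comm)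
qed

lemma P_inclusion: "unital_inclusion P A"
  using P_subalgebra A_subalgebra by (auto simp: unital_inclusion_def P_def)

lemma E_P_conditional_expectation: "conditional_expectation P A E_P"
  unfolding conditional_expectation_def
  using P_inclusion clinear_on_subset[OF E_P_clinear] E_P_mem E_P_id E_P_mult_left E_P_mult_right
    E_P_positive by auto

end


section \<open>The two indices act in the same way\<close>

locale finite_index_bimodule_expectation =
  bimodule_conditional_expectation A UNIV B UNIV UNIV X lact ract lip rip E\<^sub>A E\<^sub>B E\<^sub>X
  + left: finite_index_expectation A E\<^sub>A + right: finite_index_expectation B E\<^sub>B
  for A :: "'c::unital_cstar_algebra set"
    and B :: "'d::unital_cstar_algebra set"
    and X :: "'y::complex_normed_vector set"
    and lact :: "'c \<Rightarrow> 'y \<Rightarrow> 'y"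
    and ract :: "'y \<Rightarrow> 'd \<Rightarrow> 'y"
    and lip :: "'y \<Rightarrow> 'y \<Rightarrow> 'c"
    and rip :: "'y \<Rightarrow> 'y \<Rightarrow> 'd"
    and E\<^sub>A :: "'c \<Rightarrow> 'c" and E\<^sub>B :: "'d \<Rightarrow> 'd" and E\<^sub>X :: "'y \<Rightarrow> 'y"
begin

lemmas lact_clinear = lact_linear_right[OF UNIV_I]
  and lact_clinear_scalar = lact_linear_left[OF UNIV_I]
  and ract_clinear = ract_linear_left[OF UNIV_I]
  and ract_clinear_scalar = ract_linear_right[OF UNIV_I]
  and lip_clinear = lip_linear[OF UNIV_I]
  and rip_clinear = rip_linear[OF UNIV_I]
  and lact_lact = lact_mult[OF UNIV_I UNIV_I UNIV_I, symmetric]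
  and ract_ract = ract_mult[OF UNIV_I UNIV_I UNIV_I, symmetric]
  and ract_lact = lact_ract[OF UNIV_I UNIV_I UNIV_I]
  and lip_lact_left = lip_lact[OF UNIV_I UNIV_I UNIV_I]
  and rip_ract_right = rip_ract[OF UNIV_I UNIV_I UNIV_I]
  and rip_lact_left = rip_lact[OF UNIV_I UNIV_I UNIV_I]
  and lip_ract_left = lip_ract[OF UNIV_I UNIV_I UNIV_I]
  and lip_lact_eq = lip_rip[OF UNIV_I UNIV_I UNIV_I]
  and star_lip' = star_lip[OF UNIV_I UNIV_I]
  and star_rip' = star_rip[OF UNIV_I UNIV_I]
  and lact_1 = lact_one[OF UNIV_I]
  and ract_1 = ract_one[OF UNIV_I]

lemma lip_lact_right: "lip x (lact c y) = lip x y * star c"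
  by (metis lip_lact_left star_lip' star_mult)

lemma rip_ract_left: "rip (ract x d) y = star d * rip x y"
  by (metis rip_ract_right star_rip' star_mult)

lemma lip_ract_right: "lip x (ract y d) = lip (ract x (star d)) y"
  by (simp add: lip_ract_left star_star)

lemma rip_lact_right: "rip x (lact c y) = rip (lact (star c) x) y"
  by (simp add: rip_lact_left star_star)

lemma bounded_linear_lact: "bounded_linear (lact c)"
proof (rule bounded_linear_intro[where K = "norm c"])
  fix x
  have "(norm (lact c x))\<^sup>2 = norm (c * lip x x * star c)"
    by (simp add: lip_norm lip_lact_left lip_lact_right mult.assoc)
  also have "\<dots> \<le> norm c * norm (lip x x) * norm c"
    using norm_mult3_ineq[of c "lip x x" "star c"] by simp
  also have "\<dots> = (norm x * norm c)\<^sup>2"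
    by (simp add: lip_norm[of x] power_mult_distrib power2_eq_square)
  finally show "norm (lact c x) \<le> norm x * norm c"
    by (rule power2_le_imp_le) simp
qed (simp_all add: clinear_add[OF lact_clinear] clinear_scaleR[OF lact_clinear])

lemma bounded_linear_ract: "bounded_linear (\<lambda>y. ract y d)"
proof (rule bounded_linear_intro[where K = "norm d"])
  fix x
  have "(norm (ract x d))\<^sup>2 = norm (star d * rip x x * d)"
    by (simp add: rip_norm rip_ract_left rip_ract_right mult.assoc)
  also have "\<dots> \<le> norm d * norm (rip x x) * norm d"
    using norm_mult3_ineq[of "star d" "rip x x" d] by simp
  also have "\<dots> = (norm x * norm d)\<^sup>2"
    by (simp add: rip_norm[of x] power_mult_distrib power2_eq_square)
  finally show "norm (ract x d) \<le> norm x * norm d"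
    by (rule power2_le_imp_le) simp
qed (simp_all add: clinear_add[OF ract_clinear] clinear_scaleR[OF ract_clinear])

lemma one_mem_lip_span: "1 \<in> ip_span lip X X"
proof (rule dense_left_ideal_contains_one[OF left.A_subalgebra XX_left_full])
  fix a s assume a: "a \<in> A" and s: "s \<in> ip_span lip X X"
  show "a * s \<in> ip_span lip X X"
    by (rule ip_span_mult_left[OF _ s]) (metis X_lact a lip_lact_left)
qed

lemma one_mem_rip_span: "1 \<in> ip_span rip X X"
proof (rule dense_left_ideal_contains_one[OF right.A_subalgebra XX_right_full])
  fix b s assume b: "b \<in> B" and s: "s \<in> ip_span rip X X"
  show "b * s \<in> ip_span rip X X"
    by (rule ip_span_mult_left[OF _ s]) (metis X_ract b right.A_star rip_ract_left star_star)
qed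

text \<open>
  Write \<open>y = y \<cdot> 1\<close> with 1 a sum of inner products of elements of \<open>X\<close>, and use
  \<open>y \<cdot> \<langle>x, x'\<rangle> = \<langle>y, x\<rangle> \<cdot> x'\<close>.
\<close>

lemma span_lact_X: "y \<in> cspan {lact c x |c x. x \<in> X}"
proof -
  have "ract y 1 \<in> cspan {lact c x |c x. x \<in> X}"
  proof (rule clinear_span_subset[OF ract_clinear_scalar _ _ one_mem_rip_span[unfolded ip_span_def]])
    fix d assume "d \<in> {rip x x' |x x'. x \<in> X \<and> x' \<in> X}"
    then obtain x x' where d: "d = rip x x'" and "x' \<in> X" by blast
    then have "lact (lip y x) x' \<in> {lact c x |c x. x \<in> X}" by blast
    then show "ract y d \<in> cspan {lact c x |c x. x \<in> X}"
      unfolding d lip_lact_eq by (rule complex_vector.span_base)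
  qed simp
  then show ?thesis by (simp add: ract_1)
qed

lemma span_X_ract: "y \<in> cspan {ract x d |x d. x \<in> X}"
proof -
  have "lact 1 y \<in> cspan {ract x d |x d. x \<in> X}"
  proof (rule clinear_span_subset[OF lact_clinear_scalar _ _ one_mem_lip_span[unfolded ip_span_def]])
    fix c assume "c \<in> {lip x x' |x x'. x \<in> X \<and> x' \<in> X}"
    then obtain x x' where c: "c = lip x x'" and "x \<in> X" by blast
    then have "ract x (rip x' y) \<in> {ract x d |x d. x \<in> X}" by blast
    then show "lact c y \<in> cspan {ract x d |x d. x \<in> X}"
      unfolding c lip_lact_eq by (rule complex_vector.span_base)
  qed simp
  then show ?thesis by (simp add: lact_1)
qed

lemma EX_mem: "E\<^sub>X y \<in> X"
  using EX_onto by blast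

lemma EX_expand_left:
  assumes "quasi_basis UNIV E\<^sub>A n u"
  shows "(\<Sum>i<n. lact (u i) (E\<^sub>X (lact (star (u i)) y))) = y"
proof (rule clinear_eq_on_span[OF _ _ _ span_lact_X, of "\<lambda>y. \<Sum>i<n. lact (u i) (E\<^sub>X (lact (star (u i)) y))" "\<lambda>y. y"])
  show "clinear_on UNIV (\<lambda>y. \<Sum>i<n. lact (u i) (E\<^sub>X (lact (star (u i)) y)))"
    by (intro clinear_on_sum clinear_on_compose[OF lact_clinear] clinear_on_compose[OF EX_linear]
        lact_clinear)
  fix y assume "y \<in> {lact c x |c x. x \<in> X}"
  then obtain c x where y: "y = lact c x" and x: "x \<in> X" by blast
  have "(\<Sum>i<n. lact (u i) (E\<^sub>X (lact (star (u i)) y)))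
      = (\<Sum>i<n. lact (u i * E\<^sub>A (star (u i) * c)) x)"
    by (simp add: y lact_lact EX_lact_X x)
  also have "\<dots> = lact (\<Sum>i<n. u i * E\<^sub>A (star (u i) * c)) x"
    by (rule clinear_sum[OF lact_clinear_scalar, symmetric])
  finally show "(\<Sum>i<n. lact (u i) (E\<^sub>X (lact (star (u i)) y))) = y"
    by (simp only: quasi_basisD(1)[OF assms] y)
qed (simp add: clinear_on_def)

lemma EX_expand_right:
  assumes "quasi_basis UNIV E\<^sub>B n w"
  shows "(\<Sum>j<n. ract (E\<^sub>X (ract y (w j))) (star (w j))) = y"
proof (rule clinear_eq_on_span[OF _ _ _ span_X_ract, of "\<lambda>y. \<Sum>j<n. ract (E\<^sub>X (ract y (w j))) (star (w j))" "\<lambda>y. y"])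
  show "clinear_on UNIV (\<lambda>y. \<Sum>j<n. ract (E\<^sub>X (ract y (w j))) (star (w j)))"
    by (intro clinear_on_sum clinear_on_compose[OF ract_clinear] clinear_on_compose[OF EX_linear]
        ract_clinear)
  fix y assume "y \<in> {ract x d |x d. x \<in> X}"
  then obtain x d where y: "y = ract x d" and x: "x \<in> X" by blast
  have "(\<Sum>j<n. ract (E\<^sub>X (ract y (w j))) (star (w j)))
      = (\<Sum>j<n. ract x (E\<^sub>B (d * w j) * star (w j)))"
    by (simp add: y ract_ract EX_ract_X x)
  also have "\<dots> = ract x (\<Sum>j<n. E\<^sub>B (d * w j) * star (w j))"
    by (rule clinear_sum[OF ract_clinear_scalar, symmetric])
  finally show "(\<Sum>j<n. ract (E\<^sub>X (ract y (w j))) (star (w j))) = y"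
    by (simp only: quasi_basisD(2)[OF assms] y)
qed (simp add: clinear_on_def)

text \<open>
  Expanding every \<open>y \<cdot> w\<^sub>j\<close> from the left and then contracting from the right turns
  \<open>\<Sum>\<^sub>j y \<cdot> w\<^sub>j w\<^sub>j\<^sup>*\<close> into \<open>\<Sum>\<^sub>i u\<^sub>i u\<^sub>i\<^sup>* \<cdot> y\<close>.
\<close>

lemma index_action: "lact left.k y = ract y right.k"
proof -
  obtain n u where u: "quasi_basis UNIV E\<^sub>A n u"
    using left.finite_index by (auto simp: index_finite_type_def)
  obtain m w where w: "quasi_basis UNIV E\<^sub>B m w"
    using right.finite_index by (auto simp: index_finite_type_def)
  have "ract y right.k = (\<Sum>j<m. ract (ract y (w j)) (star (w j)))"
    by (simp add: quasi_basisD(3)[OF w] clinear_sum[OF ract_clinear_scalar] ract_ract)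
  also have "\<dots> = (\<Sum>j<m. ract (\<Sum>i<n. lact (u i) (E\<^sub>X (lact (star (u i)) (ract y (w j))))) (star (w j)))"
    by (simp only: EX_expand_left[OF u])
  also have "\<dots> = (\<Sum>j<m. \<Sum>i<n. lact (u i) (ract (E\<^sub>X (ract (lact (star (u i)) y) (w j))) (star (w j))))"
    by (simp add: clinear_sum[OF ract_clinear] ract_lact)
  also have "\<dots> = (\<Sum>i<n. lact (u i) (\<Sum>j<m. ract (E\<^sub>X (ract (lact (star (u i)) y) (w j))) (star (w j))))"
    by (subst sum.swap) (simp add: clinear_sum[OF lact_clinear])
  also have "\<dots> = (\<Sum>i<n. lact (u i * star (u i)) y)"
    by (simp only: EX_expand_right[OF w] lact_lact)
  also have "\<dots> = lact left.k y"
    by (simp add: quasi_basisD(3)[OF u] clinear_sum[OF lact_clinear_scalar])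
  finally show ?thesis by simp
qed

text \<open>
  \<open>\<langle>x, y\<rangle> l = \<langle>x, k \<cdot> y\<rangle>\<close> lies in \<open>B\<close> for \<open>x, y \<in> X\<close>, and 1 is a sum of such inner products.
\<close>

lemma right_index_mem:
  assumes "left.k \<in> A"
  shows "right.k \<in> B"
proof -
  have "1 * right.k \<in> B"
  proof (rule clinear_span_subset[OF clinear_on_mult_right right.A_subspace _ one_mem_rip_span[unfolded ip_span_def]])
    fix d assume "d \<in> {rip x y |x y. x \<in> X \<and> y \<in> X}"
    then obtain x y where d: "d = rip x y" and xy: "x \<in> X" "y \<in> X" by blast
    have "d * right.k = rip x (lact left.k y)" by (simp add: d index_action rip_ract_right)
    then show "d * right.k \<in> B" using xy X_lact X_rip assms by simp
  qed
  then show ?thesis by simp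
qed

lemma X_equivalence_bimodule: "equivalence_bimodule A B X lact ract lip rip"
proof -
  have complete: "complete X"
    using complete_closed_subset[OF X_closed _ left_complete] by simp
  have "full_left_hilbert_module A X lact lip"
    by (rule full_left_hilbert_module.intro)
      (auto simp: X_lact X_lip lact_1 lact_lact lip_lact_left star_lip' lip_positive lip_norm
        left.A_subalgebra X_subspace complete XX_left_full
        clinear_on_subset[OF lact_clinear] clinear_on_subset[OF lact_clinear_scalar]
        clinear_on_subset[OF lip_clinear])
  moreover have "full_right_hilbert_module B X ract rip"
    by (rule full_right_hilbert_module.intro)
      (auto simp: X_ract X_rip ract_1 ract_ract rip_ract_right star_rip' rip_positive rip_norm
        right.A_subalgebra X_subspace complete XX_right_full
        clinear_on_subset[OF ract_clinear] clinear_on_subset[OF ract_clinear_scalar]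
        clinear_on_subset[OF rip_clinear])
  moreover have "equivalence_bimodule_axioms A B X lact ract lip rip"
    by (rule equivalence_bimodule_axioms.intro)
      (auto simp: ract_lact rip_lact_left lip_ract_left lip_lact_eq)
  ultimately show ?thesis by (rule equivalence_bimodule.intro)
qed

end


section \<open>The bimodule between the commutants of the projections\<close>

text \<open>
  The names carry over from one side to the other: \<open>right.P\<close> and \<open>right.E_P\<close> are the algebra
  \<open>Q\<close> and the expectation \<open>E\<^sub>Q\<close> belonging to \<open>q\<close>.
\<close>

locale projection_bimodule =
  finite_index_bimodule_expectation A B X lact ract lip rip E\<^sub>A E\<^sub>B E\<^sub>X
  + left: index_projection A E\<^sub>A p + right: index_projection B E\<^sub>B q
  for A :: "'c::unital_cstar_algebra set"
    and B :: "'d::unital_cstar_algebra set"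
    and X :: "'y::complex_normed_vector set"
    and lact :: "'c \<Rightarrow> 'y \<Rightarrow> 'y"
    and ract :: "'y \<Rightarrow> 'd \<Rightarrow> 'y"
    and lip :: "'y \<Rightarrow> 'y \<Rightarrow> 'c"
    and rip :: "'y \<Rightarrow> 'y \<Rightarrow> 'd"
    and E\<^sub>A :: "'c \<Rightarrow> 'c" and E\<^sub>B :: "'d \<Rightarrow> 'd" and E\<^sub>X :: "'y \<Rightarrow> 'y"
    and p :: 'c and q :: 'd
begin

text \<open>
  Both sides are linear in \<open>y\<close>, and on the generators \<open>c \<cdot> x\<close> the equation is the identity
  \<open>p c = k p E\<^sub>A(p c)\<close> applied to \<open>x\<close>.
\<close>

lemma p_lact_eq: "lact p y = lact left.k (lact p (E\<^sub>X (lact p y)))"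
proof (rule clinear_eq_on_span[OF lact_clinear _ _ span_lact_X])
  show "clinear_on UNIV (\<lambda>y. lact left.k (lact p (E\<^sub>X (lact p y))))"
    by (intro clinear_on_compose[OF lact_clinear] clinear_on_compose[OF EX_linear] lact_clinear)
  fix y assume "y \<in> {lact c x |c x. x \<in> X}"
  then obtain c x where y: "y = lact c x" and x: "x \<in> X" by blast
  have "lact left.k (lact p (E\<^sub>X (lact p y))) = lact (left.k * (p * E\<^sub>A (p * c))) x"
    by (simp add: y lact_lact EX_lact_X x)
  also have "\<dots> = lact p y" by (simp add: y lact_lact flip: left.p_mult_eq)
  finally show "lact p y = lact left.k (lact p (E\<^sub>X (lact p y)))" by simp
qed

lemma ract_q_eq: "ract y q = ract (ract (E\<^sub>X (ract y q)) right.k) q"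
proof (rule clinear_eq_on_span[OF ract_clinear _ _ span_X_ract])
  show "clinear_on UNIV (\<lambda>y. ract (ract (E\<^sub>X (ract y q)) right.k) q)"
    by (intro clinear_on_compose[OF ract_clinear] clinear_on_compose[OF EX_linear] ract_clinear)
  fix y assume "y \<in> {ract x d |x d. x \<in> X}"
  then obtain x d where y: "y = ract x d" and x: "x \<in> X" by blast
  have "ract (ract (E\<^sub>X (ract y q)) right.k) q = ract x (E\<^sub>B (d * q) * right.k * q)"
    by (simp add: y ract_ract EX_ract_X x)
  also have "E\<^sub>B (d * q) * right.k * q = d * q"
    using right.mult_p_eq[of d] right.index_central[of "E\<^sub>B (d * q)"] by (simp add: mult.assoc[symmetric])
  finally show "ract y q = ract (ract (E\<^sub>X (ract y q)) right.k) q" by (simp add: y ract_ract)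
qed

definition Z :: "'y set" where "Z = {x \<in> X. lact p x = ract x q}"

text \<open>
  The formula is forced: \<open>p \<cdot> E\<^sub>Z(x) = p \<cdot> x \<cdot> q\<close> should hold, and \<open>k \<cdot> E\<^sub>X(p \<cdot> w) = w\<close> for \<open>w \<in> X\<close>
  because \<open>k E\<^sub>A(p) = 1\<close>.
\<close>

definition E_Z :: "'y \<Rightarrow> 'y" where "E_Z x = lact left.k (E\<^sub>X (lact p (ract x q)))"

lemma E_Z_eq_right: "E_Z x = ract (E\<^sub>X (lact p (ract x q))) right.k"
  by (simp add: E_Z_def index_action)

lemma p_lact_E_Z: "lact p (E_Z x) = lact p (ract x q)"
  by (subst p_lact_eq[of "ract x q"]) (simp add: E_Z_def lact_lact left.index_central)

lemma E_Z_ract_q: "ract (E_Z x) q = lact p (ract x q)"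
  using ract_q_eq[of "lact p x"] by (simp add: E_Z_eq_right ract_lact)

lemma Z_subset: "Z \<subseteq> X"
  by (auto simp: Z_def)

lemma Z_D: "z \<in> Z \<Longrightarrow> z \<in> X" "z \<in> Z \<Longrightarrow> lact p z = ract z q"
  by (auto simp: Z_def)

lemma E_Z_mem: "E_Z x \<in> Z"
  by (simp add: Z_def p_lact_E_Z E_Z_ract_q) (simp add: E_Z_def X_lact left.index_mem EX_mem)

lemma E_Z_clinear: "clinear_on UNIV E_Z"
  unfolding E_Z_def
  by (intro clinear_on_compose[OF lact_clinear] clinear_on_compose[OF EX_linear] ract_clinear)

lemma E_Z_lact: "z \<in> Z \<Longrightarrow> E_Z (lact a z) = lact (left.E_P a) z"
proof -
  assume z: "z \<in> Z"
  have "lact p (ract (lact a z) q) = lact (p * a * p) z"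
    by (simp add: ract_lact lact_lact mult.assoc flip: Z_D(2)[OF z])
  then show ?thesis
    by (simp add: E_Z_def EX_lact_X Z_D(1)[OF z] lact_lact left.E_P_def)
qed

lemma E_Z_ract: "z \<in> Z \<Longrightarrow> E_Z (ract z b) = ract z (right.E_P b)"
proof -
  assume z: "z \<in> Z"
  have "lact p (ract (ract z b) q) = ract z (q * b * q)"
    by (simp add: Z_D(2)[OF z] ract_ract mult.assoc flip: ract_lact)
  then show ?thesis
    by (simp add: E_Z_eq_right EX_ract_X Z_D(1)[OF z] ract_ract right.E_P_def right.index_central)
qed

lemma E_Z_id: "z \<in> Z \<Longrightarrow> E_Z z = z"
  using E_Z_lact[of z 1] left.E_P_id[of 1] left.P_subalgebra
  by (simp add: lact_1 unital_cstar_subalgebra_def)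

lemma E_Z_lact_P: "a \<in> left.P \<Longrightarrow> E_Z (lact a x) = lact a (E_Z x)"
proof -
  assume "a \<in> left.P"
  then have a: "a \<in> A" "p * a = a * p" by (auto simp: left.P_def)
  have "lact p (ract (lact a x) q) = lact a (lact p (ract x q))"
    by (simp add: ract_lact lact_lact a(2))
  then have "E_Z (lact a x) = lact left.k (lact a (E\<^sub>X (lact p (ract x q))))"
    by (simp only: E_Z_def EX_lact_A[OF a(1) UNIV_I])
  then show ?thesis by (simp add: E_Z_def lact_lact left.index_central)
qed

lemma E_Z_ract_Q: "b \<in> right.P \<Longrightarrow> E_Z (ract x b) = ract (E_Z x) b"
proof -
  assume "b \<in> right.P"
  then have b: "b \<in> B" "q * b = b * q" by (auto simp: right.P_def)
  have "lact p (ract (ract x b) q) = ract (lact p (ract x q)) b"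
    by (simp add: ract_lact ract_ract b(2))
  then have "E_Z (ract x b) = lact left.k (ract (E\<^sub>X (lact p (ract x q))) b)"
    by (simp only: E_Z_def EX_ract_B[OF UNIV_I b(1)])
  then show ?thesis by (simp add: E_Z_def ract_lact)
qed

lemma E_P_lip: "z \<in> Z \<Longrightarrow> left.E_P (lip x z) = lip (E_Z x) z"
proof -
  assume z: "z \<in> Z"
  have "p * lip x z * p = lip (lact p x) (lact p z)"
    by (simp add: lip_lact_left lip_lact_right left.p_star mult.assoc)
  also have "\<dots> = lip (lact p (ract x q)) z"
    by (simp add: Z_D(2)[OF z] lip_ract_right right.p_star ract_lact)
  finally have "left.E_P (lip x z) = left.k * lip (E\<^sub>X (lact p (ract x q))) z"
    by (simp only: left.E_P_def EA_lip[OF UNIV_I Z_D(1)[OF z]])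
  then show ?thesis by (simp add: E_Z_def lip_lact_left)
qed

lemma E_Q_rip: "z \<in> Z \<Longrightarrow> right.E_P (rip x z) = rip (E_Z x) z"
proof -
  assume z: "z \<in> Z"
  have "q * rip x z * q = rip (ract x q) (ract z q)"
    by (simp add: rip_ract_left rip_ract_right right.p_star mult.assoc)
  also have "\<dots> = rip (lact p (ract x q)) z"
    by (simp add: rip_lact_right left.p_star flip: Z_D(2)[OF z])
  finally have "right.E_P (rip x z) = right.k * rip (E\<^sub>X (lact p (ract x q))) z"
    by (simp only: right.E_P_def EB_rip[OF UNIV_I Z_D(1)[OF z]])
  then show ?thesis by (simp add: E_Z_eq_right rip_ract_left right.index_star)
qed

text \<open>
  The linear map \<open>d \<mapsto> k \<cdot> E\<^sub>X(p \<cdot> x \<cdot> d)\<close> sends 1 to \<open>x\<close> and \<open>a q b\<close> to \<open>E\<^sub>Z(x \<cdot> a) \<cdot> b\<close>, and 1 is a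
  sum of elements \<open>a q b\<close> with \<open>a, b \<in> B\<close>.
\<close>

lemma X_subset_span_Z_ract: "x \<in> X \<Longrightarrow> x \<in> cspan {ract z b |z b. z \<in> Z \<and> b \<in> B}"
proof -
  assume x: "x \<in> X"
  let ?f = "\<lambda>d. lact left.k (E\<^sub>X (lact p (ract x d)))"
  have "?f 1 \<in> cspan {ract z b |z b. z \<in> Z \<and> b \<in> B}"
  proof (rule clinear_span_subset[OF _ _ _ right.one_mem_span_A_p_A])
    show "clinear_on UNIV ?f"
      by (intro clinear_on_compose[OF lact_clinear] clinear_on_compose[OF EX_linear]
          ract_clinear_scalar)
    fix d assume "d \<in> {a * q * b |a b. a \<in> B \<and> b \<in> B}"
    then obtain a b where d: "d = a * q * b" and b: "b \<in> B" by blast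
    have "lact p (ract x d) = ract (lact p (ract (ract x a) q)) b"
      by (simp add: d ract_ract ract_lact mult.assoc)
    then have "?f d = ract (E_Z (ract x a)) b"
      by (simp only: EX_ract_B[OF UNIV_I b] E_Z_def ract_lact[of left.k])
    moreover have "ract (E_Z (ract x a)) b \<in> {ract z b |z b. z \<in> Z \<and> b \<in> B}"
      using E_Z_mem b by blast
    ultimately show "?f d \<in> cspan {ract z b |z b. z \<in> Z \<and> b \<in> B}"
      by (simp only: complex_vector.span_base)
  qed simp
  moreover have "?f 1 = x"
    by (simp add: ract_1 EX_lact_X x lact_lact left.index_E_p lact_1)
  ultimately show ?thesis by simp
qed

lemma X_subset_span_lact_Z: "x \<in> X \<Longrightarrow> x \<in> cspan {lact a z |a z. a \<in> A \<and> z \<in> Z}"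
proof -
  assume x: "x \<in> X"
  let ?f = "\<lambda>c. ract (E\<^sub>X (ract (lact c x) q)) right.k"
  have "?f 1 \<in> cspan {lact a z |a z. a \<in> A \<and> z \<in> Z}"
  proof (rule clinear_span_subset[OF _ _ _ left.one_mem_span_A_p_A])
    show "clinear_on UNIV ?f"
      by (intro clinear_on_compose[OF ract_clinear] clinear_on_compose[OF EX_linear]
          lact_clinear_scalar)
    fix c assume "c \<in> {a * p * b |a b. a \<in> A \<and> b \<in> A}"
    then obtain a b where c: "c = a * p * b" and a: "a \<in> A" by blast
    have "ract (lact c x) q = lact a (lact p (ract (lact b x) q))"
      by (simp add: c lact_lact ract_lact mult.assoc)
    then have "?f c = lact a (E_Z (lact b x))"
      by (simp only: EX_lact_A[OF a UNIV_I] E_Z_eq_right ract_lact[of a])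
    moreover have "lact a (E_Z (lact b x)) \<in> {lact a z |a z. a \<in> A \<and> z \<in> Z}"
      using E_Z_mem a by blast
    ultimately show "?f c \<in> cspan {lact a z |a z. a \<in> A \<and> z \<in> Z}"
      by (simp only: complex_vector.span_base)
  qed simp
  moreover have "?f 1 = x"
    by (simp add: lact_1 EX_ract_X x ract_ract right.E_p_index ract_1)
  ultimately show ?thesis by simp
qed

text \<open>
  In the second argument, \<open>X\<close> may be replaced by the generators \<open>z \<cdot> b\<close>, and
  \<open>\<langle>x, z \<cdot> b\<rangle> = \<langle>x \<cdot> b\<^sup>*, z\<rangle>\<close>.
\<close>

lemma one_mem_lip_span_X_Z: "1 \<in> ip_span lip X Z"
proof -
  let ?S = "ip_span lip X Z"
  have S: "csubspace ?S" by (simp add: ip_span_def)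
  have gen: "lip x y \<in> ?S" if x: "x \<in> X" and y: "y \<in> X" for x y
  proof -
    have "csubspace {y. star (lip y x) \<in> ?S}"
      using S by (auto simp: complex_vector.subspace_def clinear_add[OF lip_clinear]
          clinear_scaleC[OF lip_clinear] clinear_zero[OF lip_clinear] star_add star_scaleC)
    moreover have "star (lip (ract z b) x) \<in> ?S" if "z \<in> Z" "b \<in> B" for z b
    proof -
      have "star (lip (ract z b) x) = lip (ract x (star b)) z"
        by (simp add: star_lip' lip_ract_right)
      then show ?thesis using mem_ip_span[of "ract x (star b)" X z Z lip] x that X_ract right.A_star
        by simp
    qed
    ultimately have "cspan {ract z b |z b. z \<in> Z \<and> b \<in> B} \<subseteq> {y. star (lip y x) \<in> ?S}"
      by (intro complex_vector.span_minimal) auto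
    with X_subset_span_Z_ract[OF y] show ?thesis by (auto simp: star_lip')
  qed
  have "ip_span lip X X \<subseteq> ?S"
    unfolding ip_span_def[of lip X X] by (rule complex_vector.span_minimal) (use gen S in auto)
  then show ?thesis using one_mem_lip_span by blast
qed

lemma one_mem_rip_span_X_Z: "1 \<in> ip_span rip X Z"
proof -
  let ?S = "ip_span rip X Z"
  have S: "csubspace ?S" by (simp add: ip_span_def)
  have gen: "rip x y \<in> ?S" if x: "x \<in> X" and y: "y \<in> X" for x y
  proof (rule clinear_span_subset[OF rip_clinear S _ X_subset_span_lact_Z[OF y]])
    fix y assume "y \<in> {lact a z |a z. a \<in> A \<and> z \<in> Z}"
    then obtain a z where "y = lact a z" "a \<in> A" "z \<in> Z" by blast
    then show "rip x y \<in> ?S"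
      using mem_ip_span[of "lact (star a) x" X z Z rip] x X_lact left.A_star
      by (simp add: rip_lact_right)
  qed
  have "ip_span rip X X \<subseteq> ?S"
    unfolding ip_span_def[of rip X X] by (rule complex_vector.span_minimal) (use gen S in auto)
  then show ?thesis using one_mem_rip_span by blast
qed

text \<open>
  Apply \<open>E\<^sub>P\<close>, which fixes 1 and sends \<open>\<langle>x, z\<rangle>\<close> to \<open>\<langle>E\<^sub>Z(x), z\<rangle>\<close>.
\<close>

lemma one_mem_lip_span_Z_Z: "1 \<in> ip_span lip Z Z"
proof -
  have "left.E_P 1 \<in> ip_span lip Z Z"
    by (rule clinear_span_subset[OF left.E_P_clinear _ _ one_mem_lip_span_X_Z[unfolded ip_span_def]])
      (auto simp: E_P_lip E_Z_mem mem_ip_span, simp add: ip_span_def)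
  then show ?thesis
    using left.E_P_id[of 1] left.P_subalgebra by (simp add: unital_cstar_subalgebra_def)
qed

lemma one_mem_rip_span_Z_Z: "1 \<in> ip_span rip Z Z"
proof -
  have "right.E_P 1 \<in> ip_span rip Z Z"
    by (rule clinear_span_subset[OF right.E_P_clinear _ _ one_mem_rip_span_X_Z[unfolded ip_span_def]])
      (auto simp: E_Q_rip E_Z_mem mem_ip_span, simp add: ip_span_def)
  then show ?thesis
    using right.E_P_id[of 1] right.P_subalgebra by (simp add: unital_cstar_subalgebra_def)
qed

lemma Z_lact: "a \<in> left.P \<Longrightarrow> z \<in> Z \<Longrightarrow> lact a z \<in> Z"
  by (simp add: left.P_def Z_def X_lact ract_lact) (metis lact_lact)

lemma Z_ract: "z \<in> Z \<Longrightarrow> b \<in> right.P \<Longrightarrow> ract z b \<in> Z"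
  by (simp add: right.P_def Z_def X_ract flip: ract_lact) (simp add: ract_ract)

lemma Z_lip: "z \<in> Z \<Longrightarrow> z' \<in> Z \<Longrightarrow> lip z z' \<in> left.P"
  by (metis E_P_lip E_Z_id left.E_P_mem)

lemma Z_rip: "z \<in> Z \<Longrightarrow> z' \<in> Z \<Longrightarrow> rip z z' \<in> right.P"
  by (metis E_Q_rip E_Z_id right.E_P_mem)

lemma Z_closed: "closed Z"
proof -
  have "closed (X \<inter> {x. lact p x = ract x q})"
    by (intro closed_Int X_closed closed_Collect_eq linear_continuous_on
        bounded_linear_lact bounded_linear_ract)
  moreover have "X \<inter> {x. lact p x = ract x q} = Z" by (auto simp: Z_def)
  ultimately show ?thesis by simp
qed

lemma Z_subspace: "csubspace Z"
  using X_subspace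
  by (auto simp: complex_vector.subspace_def Z_def clinear_add[OF lact_clinear]
      clinear_add[OF ract_clinear] clinear_scaleC[OF lact_clinear] clinear_scaleC[OF ract_clinear]
      clinear_zero[OF lact_clinear] clinear_zero[OF ract_clinear])

lemma Z_strongly_Morita_equivalent:
  "strongly_Morita_equivalent_inclusions left.P A right.P B X Z lact ract lip rip"
proof (intro strongly_Morita_equivalent_inclusions.intro X_equivalence_bimodule
    strongly_Morita_equivalent_inclusions_axioms.intro)
  show "closure (ip_span lip Z Z) = left.P"
    by (rule closure_ip_span_eq[OF left.P_subalgebra one_mem_lip_span_Z_Z Z_lip])
      (auto simp flip: lip_lact_left intro: Z_lact)
  show "closure (ip_span lip X Z) = A"
    by (rule closure_ip_span_eq[OF left.A_subalgebra one_mem_lip_span_X_Z])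
      (auto simp: X_lip Z_D simp flip: lip_lact_left intro: X_lact)
  have b: "b * rip x y = rip (ract x (star b)) y" for b x y
    by (simp add: rip_ract_left star_star)
  have Q_star: "b \<in> right.P \<Longrightarrow> star b \<in> right.P" for b
    using right.P_subalgebra by (simp add: unital_cstar_subalgebra_def)
  show "closure (ip_span rip Z Z) = right.P"
    by (rule closure_ip_span_eq[OF right.P_subalgebra one_mem_rip_span_Z_Z Z_rip])
      (auto simp: b intro: Z_ract Q_star)
  show "closure (ip_span rip X Z) = B"
    by (rule closure_ip_span_eq[OF right.A_subalgebra one_mem_rip_span_X_Z])
      (auto simp: b X_rip Z_D intro: X_ract right.A_star)
qed (auto intro: left.P_inclusion right.P_inclusion Z_subspace Z_closed Z_lact Z_lip Z_ract Z_rip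
    Z_D(1))

lemma Z_bimodule_conditional_expectation:
  "bimodule_conditional_expectation left.P A right.P B X Z lact ract lip rip
     left.E_P right.E_P E_Z"
proof (intro bimodule_conditional_expectation.intro Z_strongly_Morita_equivalent
    bimodule_conditional_expectation_axioms.intro)
  show "E_Z ` X = Z" using E_Z_mem E_Z_id Z_subset by force
qed (auto simp: left.E_P_conditional_expectation right.E_P_conditional_expectation
    clinear_on_subset[OF E_Z_clinear] E_Z_lact E_Z_ract E_Z_lact_P E_Z_ract_Q E_P_lip E_Q_rip)

end

lemma conditional_expectation_cong:
  assumes E: "conditional_expectation A C E" and eq: "\<And>c. c \<in> C \<Longrightarrow> E' c = E c"
  shows "conditional_expectation A C E'"
proof -
  have C: "csubspace C" "A \<subseteq> C" "\<And>a b. a \<in> C \<Longrightarrow> b \<in> C \<Longrightarrow> a * b \<in> C"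
    using E by (auto simp: conditional_expectation_def unital_inclusion_def
        unital_cstar_subalgebra_def)
  have "clinear_on C E'"
    using E C(1) by (simp add: conditional_expectation_def clinear_on_def eq
        complex_vector.subspace_add complex_vector.subspace_scale)
  moreover have "E' (a * c) = E (a * c)" "E' (c * a) = E (c * a)" if "a \<in> A" "c \<in> C" for a c
    using that C eq by blast+
  ultimately show ?thesis
    using E C(2) eq unfolding conditional_expectation_def by (simp add: subset_iff)
qed

lemma bimodule_conditional_expectation_cong:
  assumes E: "bimodule_conditional_expectation A C B D Y X lact ract lip rip E\<^sub>A E\<^sub>B E\<^sub>X"
    and A: "\<And>c. c \<in> C \<Longrightarrow> E\<^sub>A' c = E\<^sub>A c" and B: "\<And>d. d \<in> D \<Longrightarrow> E\<^sub>B' d = E\<^sub>B d"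
  shows "bimodule_conditional_expectation A C B D Y X lact ract lip rip E\<^sub>A' E\<^sub>B' E\<^sub>X"
proof -
  interpret bimodule_conditional_expectation A C B D Y X lact ract lip rip E\<^sub>A E\<^sub>B E\<^sub>X by (rule E)
  show ?thesis
  proof
    show "conditional_expectation A C E\<^sub>A'" "conditional_expectation B D E\<^sub>B'"
      by (rule conditional_expectation_cong[OF EA_conditional_expectation A]
          conditional_expectation_cong[OF EB_conditional_expectation B]; assumption)+
  qed (use X_subset in \<open>auto simp: A B EX_linear EX_onto EX_lact_X EX_lact_A EX_ract_X EX_ract_B
        EA_lip EB_rip lip_closed rip_closed subset_iff\<close>)
qed

theorem proposition8p5:
  fixes A :: "'c::unital_cstar_algebra set"
    and B :: "'d::unital_cstar_algebra set"
    and X :: "'y::complex_normed_vector set"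
    and lact :: "'c \<Rightarrow> 'y \<Rightarrow> 'y"
    and ract :: "'y \<Rightarrow> 'd \<Rightarrow> 'y"
    and lip :: "'y \<Rightarrow> 'y \<Rightarrow> 'c"
    and rip :: "'y \<Rightarrow> 'y \<Rightarrow> 'd"
    and E\<^sub>A E\<^sub>P :: "'c \<Rightarrow> 'c"
    and E\<^sub>B E\<^sub>Q :: "'d \<Rightarrow> 'd"
    and E\<^sub>X :: "'y \<Rightarrow> 'y"
    and p :: 'c and q :: 'd
    and P :: "'c set" and Q :: "'d set" and Z :: "'y set"
  assumes "strongly_Morita_equivalent_inclusions A UNIV B UNIV UNIV X lact ract lip rip"
    and "conditional_expectation A UNIV E\<^sub>A" and "index_finite_type UNIV E\<^sub>A"
    and "conditional_expectation B UNIV E\<^sub>B" and "index_finite_type UNIV E\<^sub>B"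
    and "bimodule_conditional_expectation A UNIV B UNIV UNIV X lact ract lip rip E\<^sub>A E\<^sub>B E\<^sub>X"
    and "Ind_W UNIV E\<^sub>A \<in> A"
    and "full_projection UNIV p"
    and "E\<^sub>A p * Ind_W UNIV E\<^sub>A = 1" and "Ind_W UNIV E\<^sub>A * E\<^sub>A p = 1"
    and "full_projection UNIV q"
    and "E\<^sub>B q * Ind_W UNIV E\<^sub>B = 1" and "Ind_W UNIV E\<^sub>B * E\<^sub>B q = 1"
    and "P = {a \<in> A. p * a = a * p}"
    and "Q = {b \<in> B. q * b = b * q}"
    and "\<And>a. a \<in> A \<Longrightarrow> E\<^sub>P a = Ind_W UNIV E\<^sub>A * E\<^sub>A (p * a * p)"
    and "\<And>b. b \<in> B \<Longrightarrow> E\<^sub>Q b = Ind_W UNIV E\<^sub>B * E\<^sub>B (q * b * q)"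
    and "Z = {x \<in> X. lact p x = ract x q}"
  shows "Ind_W UNIV E\<^sub>B \<in> B
    \<and> strongly_Morita_equivalent_inclusions P A Q B X Z lact ract lip rip
    \<and> (\<exists>E\<^sub>Z. bimodule_conditional_expectation P A Q B X Z lact ract lip rip E\<^sub>P E\<^sub>Q E\<^sub>Z)"
proof -
  interpret finite_index_bimodule_expectation A B X lact ract lip rip E\<^sub>A E\<^sub>B E\<^sub>X
    using assms(2-6)
    by (intro finite_index_bimodule_expectation.intro finite_index_expectation.intro)
  have index_B: "Ind_W UNIV E\<^sub>B \<in> B" by (rule right_index_mem[OF assms(7)])
  interpret projection_bimodule A B X lact ract lip rip E\<^sub>A E\<^sub>B E\<^sub>X p q
    using assms(7-9,11,12) index_B
    by (intro projection_bimodule.intro index_projection.intro index_projection_axioms.intro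
        finite_index_bimodule_expectation_axioms left.finite_index_expectation_axioms
        right.finite_index_expectation_axioms)
  have sets: "P = left.P" "Q = right.P" "Z = projection_bimodule.Z X lact ract p q"
    using assms(14,15,18) by (simp_all add: left.P_def right.P_def Z_def)
  have "bimodule_conditional_expectation P A Q B X Z lact ract lip rip E\<^sub>P E\<^sub>Q E_Z"
    unfolding sets
    by (rule bimodule_conditional_expectation_cong[OF Z_bimodule_conditional_expectation])
      (simp_all add: assms(16,17) left.E_P_def right.E_P_def)
  then show ?thesis
    using index_B Z_strongly_Morita_equivalent unfolding sets by blast
qed

end
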